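(* Let $\mathbb{K}$ be an algebraically closed field, let $q\in\mathbb{K}$ be a primitive $l$-th root of unity with $l\ge3$, and suppose that $l$ is odd. Let $(\lambda_1,\lambda_2)\in(\mathbb{K}^* )^2$ and, for $p\ge1$, let $Q_{p,l}=M(\lambda_1,\lambda_2)/M_{p,l}$. Then: (1) $Q_{1,l}$ is a simple $\mathcal{A}$-module. (2) When $p>1$, $Q_{p,l}$ is neither a simple nor a semisimple $\mathcal{A}$-module. (3) When $p>1$, $Q_{p,l}$ is an indecomposable $\mathcal{A}$-module.
   Context: The quantum spatial ageing algebra $\mathcal{A}$ is the $\mathbb{K}$-algebra generated by $E,K,K^{-1},X,Y$ ($K^{-1}$ the inverse of $K$) with relations $$EK=q^{-2}KE,\quad XK=q^{-1}KX,\quad YK=qKY,\quad EX=qXE,\quad EY=X+q^{-1}YE,\quad XY=qYX.$$ Modules are right modules. Let $\mathcal{B}$ be the subalgebra of $\mathcal{A}$ generated by $E,X,K^{\pm l}$. For $(\lambda_1,\lambda_2)\in(\mathbb{K}^* )^2$ let $\mathbb{K}(\lambda_1,\lambda_2)=\mathbb{K}v$ be the one-dimensional right $\mathcal{B}$-module with $vE=0$, $vX=\lambda_1v$, $vK^{\pm l}=\lambda_2^{\pm1}v$. The Verma module is $M(\lambda_1,\lambda_2):=\mathbb{K}(\lambda_1,\lambda_2)\otimes_{\mathcal{B}}\mathcal{A}$, which has $\mathbb{K}$-basis $f(m,n):=v\otimes Y^mK^n$, $m\ge0$, $0\le n\le l-1$. One has $f(m,n)X=\lambda_1q^{n-m}f(m,n)$,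 $f(m,n)Y=q^{-n}f(m+1,n)$, $f(0,n)E=0$, and $f(m,n)E=-q^{m+2n}\frac{q^{-2m}-1}{q^{-2}-1}f(m-1,n)$ for $m>0$. For $l$ odd and $p\ge1$, $M_{p,l}$ is the $\mathcal{A}$-submodule of $M(\lambda_1,\lambda_2)$ spanned by all $f(pl+i,n)$ with $i\ge0$, $0\le n\le l-1$. *)

theory Defs
  imports
    "HOL-Algebra.QuotRing"
    "HOL-Algebra.Generated_Rings"
    "HOL-Algebra.Generated_Groups"
    "HOL-Algebra.Free_Abelian_Groups"
    "HOL-Library.Poly_Mapping"
    "HOL-Computational_Algebra.Polynomial"
begin

section \<open>Right modules over a (not necessarily commutative) ring\<close>

text \<open>The \<open>module\<close> locale of HOL-Algebra requires a commutative ring of scalars. The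
  multiplicative fields \<open>mult\<close> and \<open>one\<close> of the record are never used for modules; they are
  inherited so that the additive group notions for ring records apply.\<close>

record ('a, 'b) rmodule = "'b ring" +
  ract :: "['b, 'a] \<Rightarrow> 'b" (infixl \<open>\<odot>\<^sub>r\<index>\<close> 70)

locale right_module = R: ring R + M: abelian_group M
  for R :: "('a, 'm) ring_scheme" and M :: "('a, 'b, 'n) rmodule_scheme" +
  assumes ract_closed: "\<lbrakk>x \<in> carrier M; a \<in> carrier R\<rbrakk> \<Longrightarrow> x \<odot>\<^sub>r\<^bsub>M\<^esub> a \<in> carrier M"
    and ract_add_left: "\<lbrakk>x \<in> carrier M; y \<in> carrier M; a \<in> carrier R\<rbrakk>
          \<Longrightarrow> (x \<oplus>\<^bsub>M\<^esub> y) \<odot>\<^sub>r\<^bsub>M\<^esub> a = (x \<odot>\<^sub>r\<^bsub>M\<^esub> a) \<oplus>\<^bsub>M\<^esub> (y \<odot>\<^sub>r\<^bsub>M\<^esub> a)"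
    and ract_add_right: "\<lbrakk>x \<in> carrier M; a \<in> carrier R; b \<in> carrier R\<rbrakk>
          \<Longrightarrow> x \<odot>\<^sub>r\<^bsub>M\<^esub> (a \<oplus>\<^bsub>R\<^esub> b) = (x \<odot>\<^sub>r\<^bsub>M\<^esub> a) \<oplus>\<^bsub>M\<^esub> (x \<odot>\<^sub>r\<^bsub>M\<^esub> b)"
    and ract_mult: "\<lbrakk>x \<in> carrier M; a \<in> carrier R; b \<in> carrier R\<rbrakk>
          \<Longrightarrow> x \<odot>\<^sub>r\<^bsub>M\<^esub> (a \<otimes>\<^bsub>R\<^esub> b) = (x \<odot>\<^sub>r\<^bsub>M\<^esub> a) \<odot>\<^sub>r\<^bsub>M\<^esub> b"
    and ract_one: "x \<in> carrier M \<Longrightarrow> x \<odot>\<^sub>r\<^bsub>M\<^esub> \<one>\<^bsub>R\<^esub> = x"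

definition right_submodule ::
    "'b set \<Rightarrow> ('a, 'm) ring_scheme \<Rightarrow> ('a, 'b, 'n) rmodule_scheme \<Rightarrow> bool" where
  "right_submodule N R M \<longleftrightarrow> subgroup N (add_monoid M) \<and>
     (\<forall>x\<in>N. \<forall>a\<in>carrier R. x \<odot>\<^sub>r\<^bsub>M\<^esub> a \<in> N)"

definition quotient_module :: "('a, 'b, 'n) rmodule_scheme \<Rightarrow> 'b set \<Rightarrow> ('a, 'b set) rmodule" where
  "quotient_module M N = \<lparr>carrier = a_rcosets\<^bsub>M\<^esub> N, monoid.mult = undefined, monoid.one = undefined,
     ring.zero = N, ring.add = set_add M, ract = (\<lambda>C a. \<Union>x\<in>C. N +>\<^bsub>M\<^esub> (x \<odot>\<^sub>r\<^bsub>M\<^esub> a))\<rparr>"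

definition simple_module :: "('a, 'm) ring_scheme \<Rightarrow> ('a, 'b, 'n) rmodule_scheme \<Rightarrow> bool" where
  "simple_module R M \<longleftrightarrow> right_module R M \<and> carrier M \<noteq> {\<zero>\<^bsub>M\<^esub>} \<and>
     (\<forall>N. right_submodule N R M \<longrightarrow> N = {\<zero>\<^bsub>M\<^esub>} \<or> N = carrier M)"

text \<open>\<open>M\<close> is the internal direct sum of a (possibly infinite or empty) set of simple
  submodules. The additive subgroup generated by a union of submodules is their sum.\<close>

definition semisimple_module :: "('a, 'm) ring_scheme \<Rightarrow> ('a, 'b, 'n) rmodule_scheme \<Rightarrow> bool" where
  "semisimple_module R M \<longleftrightarrow> right_module R M \<and>
     (\<exists>S. (\<forall>N\<in>S. right_submodule N R M \<and> simple_module R (M\<lparr>carrier := N\<rparr>)) \<and>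
          generate (add_monoid M) (\<Union>S) = carrier M \<and>
          (\<forall>N\<in>S. N \<inter> generate (add_monoid M) (\<Union>(S - {N})) = {\<zero>\<^bsub>M\<^esub>}))"

definition indecomposable_module :: "('a, 'm) ring_scheme \<Rightarrow> ('a, 'b, 'n) rmodule_scheme \<Rightarrow> bool" where
  "indecomposable_module R M \<longleftrightarrow> right_module R M \<and> carrier M \<noteq> {\<zero>\<^bsub>M\<^esub>} \<and>
     (\<forall>N N'. right_submodule N R M \<and> right_submodule N' R M \<and>
             N <+>\<^bsub>M\<^esub> N' = carrier M \<and> N \<inter> N' = {\<zero>\<^bsub>M\<^esub>}
             \<longrightarrow> N = {\<zero>\<^bsub>M\<^esub>} \<or> N' = {\<zero>\<^bsub>M\<^esub>})"


section \<open>Induced modules\<close>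

text \<open>For a subring \<open>R\<close> of \<open>S\<close> (both as ring records) and a right \<open>R\<close>-module \<open>N\<close>, the right
  \<open>S\<close>-module \<open>N \<otimes>\<^bsub>R\<^esub> S\<close>: the free abelian group on \<open>N \<times> S\<close> modulo biadditivity and
  \<open>R\<close>-balancedness, with \<open>(x \<otimes> t) s = x \<otimes> ts\<close>.\<close>

definition tensor_free :: "('a, 'm) ring_scheme \<Rightarrow> ('a, 'b, 'n) rmodule_scheme \<Rightarrow> ('b \<times> 'a \<Rightarrow>\<^sub>0 int) monoid"
  where "tensor_free S N = free_Abelian_group (carrier N \<times> carrier S)"

definition tensor_rels ::
    "('a, 'k) ring_scheme \<Rightarrow> ('a, 'm) ring_scheme \<Rightarrow> ('a, 'b, 'n) rmodule_scheme \<Rightarrow> ('b \<times> 'a \<Rightarrow>\<^sub>0 int) set"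
  where "tensor_rels R S N =
     {frag_of (x \<oplus>\<^bsub>N\<^esub> y, s) - frag_of (x, s) - frag_of (y, s) | x y s.
        x \<in> carrier N \<and> y \<in> carrier N \<and> s \<in> carrier S} \<union>
     {frag_of (x, s \<oplus>\<^bsub>S\<^esub> t) - frag_of (x, s) - frag_of (x, t) | x s t.
        x \<in> carrier N \<and> s \<in> carrier S \<and> t \<in> carrier S} \<union>
     {frag_of (x \<odot>\<^sub>r\<^bsub>N\<^esub> r, s) - frag_of (x, r \<otimes>\<^bsub>S\<^esub> s) | x r s.
        x \<in> carrier N \<and> r \<in> carrier R \<and> s \<in> carrier S}"

definition tensor_kernel ::
    "('a, 'k) ring_scheme \<Rightarrow> ('a, 'm) ring_scheme \<Rightarrow> ('a, 'b, 'n) rmodule_scheme \<Rightarrow> ('b \<times> 'a \<Rightarrow>\<^sub>0 int) set"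
  where "tensor_kernel R S N = generate (tensor_free S N) (tensor_rels R S N)"

definition induced_module ::
    "('a, 'k) ring_scheme \<Rightarrow> ('a, 'm) ring_scheme \<Rightarrow> ('a, 'b, 'n) rmodule_scheme
      \<Rightarrow> ('a, ('b \<times> 'a \<Rightarrow>\<^sub>0 int) set) rmodule"
  where "induced_module R S N =
    (let F = tensor_free S N; H = tensor_kernel R S N in
     \<lparr>carrier = carrier (F Mod H), monoid.mult = undefined, monoid.one = undefined,
      ring.zero = \<one>\<^bsub>F Mod H\<^esub>, ring.add = monoid.mult (F Mod H),
      ract = (\<lambda>C s. \<Union>c\<in>C. H #>\<^bsub>F\<^esub> frag_extend (\<lambda>(x, t). frag_of (x, t \<otimes>\<^bsub>S\<^esub> s)) c)\<rparr>)"

definition pure_tensor ::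
    "('a, 'k) ring_scheme \<Rightarrow> ('a, 'm) ring_scheme \<Rightarrow> ('a, 'b, 'n) rmodule_scheme
      \<Rightarrow> 'b \<Rightarrow> 'a \<Rightarrow> ('b \<times> 'a \<Rightarrow>\<^sub>0 int) set"
  where "pure_tensor R S N x s = tensor_kernel R S N #>\<^bsub>tensor_free S N\<^esub> frag_of (x, s)"


section \<open>Free associative algebras\<close>

text \<open>Words under concatenation, written additively, so that \<open>Poly_Mapping\<close> supplies the
  convolution product: \<open>'g free_word \<Rightarrow>\<^sub>0 'k\<close> is the free associative \<open>'k\<close>-algebra on \<open>'g\<close>.\<close>

datatype 'g free_word = Word (letters: "'g list")

instantiation free_word :: (type) monoid_add
begin

definition zero_free_word :: "'a free_word" where "0 = Word []"

definition plus_free_word :: "'a free_word \<Rightarrow> 'a free_word \<Rightarrow> 'a free_word" where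
  "u + w = Word (letters u @ letters w)"

instance
  by standard (simp_all add: zero_free_word_def plus_free_word_def)

end

type_synonym ('g, 'k) free_alg = "'g free_word \<Rightarrow>\<^sub>0 'k"

definition letter :: "'g \<Rightarrow> ('g, 'k::field) free_alg" where
  "letter g = Poly_Mapping.single (Word [g]) 1"

definition const :: "'k::field \<Rightarrow> ('g, 'k) free_alg" where
  "const c = Poly_Mapping.single 0 c"

definition free_algebra :: "('g, 'k::field) free_alg ring" where
  "free_algebra = \<lparr>carrier = UNIV, monoid.mult = (*), monoid.one = 1, ring.zero = 0, ring.add = (+)\<rparr>"

lemma ring_free_algebra: "ring free_algebra"
proof (rule ringI)
  show "abelian_group (free_algebra :: ('a, 'b::field) free_alg ring)"
  proof (rule abelian_groupI)
    fix x :: "('a, 'b) free_alg"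
    show "\<exists>y\<in>carrier free_algebra. y \<oplus>\<^bsub>free_algebra\<^esub> x = \<zero>\<^bsub>free_algebra\<^esub>"
      by (rule bexI[of _ "- x"]) (simp_all add: free_algebra_def)
  qed (simp_all add: free_algebra_def ac_simps)
  show "monoid (free_algebra :: ('a, 'b::field) free_alg ring)"
    by (rule monoidI) (simp_all add: free_algebra_def mult.assoc)
qed (simp_all add: free_algebra_def algebra_simps)


section \<open>The quantum spatial ageing algebra\<close>

datatype gen = GE | GK | GKinv | GX | GY

definition qsa_rels :: "'k::field \<Rightarrow> (gen, 'k) free_alg set" where
  "qsa_rels q =
    (let E = letter GE; K = letter GK; K' = letter GKinv; X = letter GX; Y = letter GY in
     {K * K' - 1, K' * K - 1,
      E * K - const (q powi (-2)) * K * E,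
      X * K - const (q powi (-1)) * K * X,
      Y * K - const q * K * Y,
      E * X - const q * X * E,
      E * Y - (X + const (q powi (-1)) * Y * E),
      X * Y - const q * Y * X})"

definition qsa_ideal :: "'k::field \<Rightarrow> (gen, 'k) free_alg set" where
  "qsa_ideal q = genideal free_algebra (qsa_rels q)"

definition qsa :: "'k::field \<Rightarrow> (gen, 'k) free_alg set ring" where
  "qsa q = free_algebra Quot (qsa_ideal q)"

lemma ring_qsa: "ring (qsa q)"
proof -
  have "ideal (qsa_ideal q) free_algebra"
    unfolding qsa_ideal_def
    by (rule ring.genideal_ideal[OF ring_free_algebra]) (simp add: free_algebra_def)
  then show ?thesis
    unfolding qsa_def by (rule ideal.quotient_is_ring)
qed

definition qsa_gen :: "'k::field \<Rightarrow> gen \<Rightarrow> (gen, 'k) free_alg set" where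
  "qsa_gen q g = qsa_ideal q +>\<^bsub>free_algebra\<^esub> letter g"

definition qsa_const :: "'k::field \<Rightarrow> 'k \<Rightarrow> (gen, 'k) free_alg set" where
  "qsa_const q c = qsa_ideal q +>\<^bsub>free_algebra\<^esub> const c"

text \<open>The \<open>'k\<close>-subalgebra generated by \<open>E, X, K\<^sup>l, K\<^sup>-\<^sup>l\<close>; including all scalars among the
  generators turns the generated subring into the generated subalgebra.\<close>

definition qsa_B :: "'k::field \<Rightarrow> nat \<Rightarrow> (gen, 'k) free_alg set ring" where
  "qsa_B q l = (qsa q)\<lparr>carrier := generate_ring (qsa q)
     (range (qsa_const q) \<union>
      {qsa_gen q GE, qsa_gen q GX, qsa_gen q GK [^]\<^bsub>qsa q\<^esub> l, qsa_gen q GKinv [^]\<^bsub>qsa q\<^esub> l})\<rparr>"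


section \<open>Verma modules\<close>

text \<open>The one-dimensional right \<open>\<B>\<close>-module \<open>\<K>(lam1,lam2) = \<K>v\<close> lives on the field itself with
  \<open>v = 1\<close>. Its action is determined on the carrier of \<open>\<B>\<close> by the required values on the
  algebra generators; it exists for \<open>lam1, lam2 \<noteq> 0\<close>. The condition on \<open>qsa_const\<close> says that the
  vector space structure coming from \<open>\<K> \<subseteq> \<B>\<close> is that of the field.\<close>

definition char_module_of_action :: "('k::field \<Rightarrow> 'a \<Rightarrow> 'k) \<Rightarrow> ('a, 'k) rmodule" where
  "char_module_of_action \<alpha> = \<lparr>carrier = UNIV, monoid.mult = undefined, monoid.one = undefined,
     ring.zero = 0, ring.add = (+), ract = \<alpha>\<rparr>"

definition is_char_action ::
    "'k::field \<Rightarrow> nat \<Rightarrow> 'k \<Rightarrow> 'k \<Rightarrow> ('k \<Rightarrow> (gen, 'k) free_alg set \<Rightarrow> 'k) \<Rightarrow> bool" where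
  "is_char_action q l lam1 lam2 \<alpha> \<longleftrightarrow>
     right_module (qsa_B q l) (char_module_of_action \<alpha>) \<and>
     (\<forall>x c. \<alpha> x (qsa_const q c) = x * c) \<and>
     \<alpha> 1 (qsa_gen q GE) = 0 \<and>
     \<alpha> 1 (qsa_gen q GX) = lam1 \<and>
     \<alpha> 1 (qsa_gen q GK [^]\<^bsub>qsa q\<^esub> l) = lam2 \<and>
     \<alpha> 1 (qsa_gen q GKinv [^]\<^bsub>qsa q\<^esub> l) = inverse lam2"

definition char_module :: "'k::field \<Rightarrow> nat \<Rightarrow> 'k \<Rightarrow> 'k \<Rightarrow> ((gen, 'k) free_alg set, 'k) rmodule" where
  "char_module q l lam1 lam2 = char_module_of_action (SOME \<alpha>. is_char_action q l lam1 lam2 \<alpha>)"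

type_synonym 'k verma_elt = "('k \<times> (gen, 'k) free_alg set \<Rightarrow>\<^sub>0 int) set"

definition verma :: "'k::field \<Rightarrow> nat \<Rightarrow> 'k \<Rightarrow> 'k \<Rightarrow> ((gen, 'k) free_alg set, 'k verma_elt) rmodule" where
  "verma q l lam1 lam2 = induced_module (qsa_B q l) (qsa q) (char_module q l lam1 lam2)"

definition verma_f :: "'k::field \<Rightarrow> nat \<Rightarrow> 'k \<Rightarrow> 'k \<Rightarrow> nat \<Rightarrow> nat \<Rightarrow> 'k verma_elt" where
  "verma_f q l lam1 lam2 m n = pure_tensor (qsa_B q l) (qsa q) (char_module q l lam1 lam2) 1
     (qsa_gen q GY [^]\<^bsub>qsa q\<^esub> m \<otimes>\<^bsub>qsa q\<^esub> qsa_gen q GK [^]\<^bsub>qsa q\<^esub> n)"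

text \<open>The \<open>\<K>\<close>-linear span, as the additive subgroup generated by all scalar multiples.\<close>

definition lin_span :: "'k::field \<Rightarrow> ((gen, 'k) free_alg set, 'b, 'n) rmodule_scheme \<Rightarrow> 'b set \<Rightarrow> 'b set" where
  "lin_span q M S = generate (add_monoid M) {x \<odot>\<^sub>r\<^bsub>M\<^esub> qsa_const q c | x c. x \<in> S}"

definition verma_sub :: "'k::field \<Rightarrow> nat \<Rightarrow> 'k \<Rightarrow> 'k \<Rightarrow> nat \<Rightarrow> 'k verma_elt set" where
  "verma_sub q l lam1 lam2 p =
     lin_span q (verma q l lam1 lam2) {verma_f q l lam1 lam2 (p * l + i) n | i n. n \<le> l - 1}"

definition verma_quotient ::
    "'k::field \<Rightarrow> nat \<Rightarrow> 'k \<Rightarrow> 'k \<Rightarrow> nat \<Rightarrow> ((gen, 'k) free_alg set, 'k verma_elt set) rmodule" where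
  "verma_quotient q l lam1 lam2 p = quotient_module (verma q l lam1 lam2) (verma_sub q l lam1 lam2 p)"

end

theory Submission
  imports Defs "HOL-Library.Function_Algebras"
begin

text \<open>
Let \<open>v\<close> be the generator of the Verma module \<open>M\<close> and \<open>f(m, n) = v \<otimes> Y\<^sup>m K\<^sup>n\<close>. Up to non-zero scalars, \<open>Y\<close> sends
\<open>f(m, n)\<close> to \<open>f(m + 1, n)\<close>, \<open>K\<close> sends it to \<open>f(m, n + 1)\<close>, where \<open>f(m, l) = lam2 f(m, 0)\<close>, and \<open>X\<close> fixes it with
eigenvalue \<open>lam1 q\<^sup>n\<^sup>-\<^sup>m\<close>. Finally \<open>E\<close> sends it to a multiple of \<open>f(m - 1, n)\<close>, and this multiple vanishes exactly
when \<open>q\<^sup>2\<^sup>m = 1\<close>, that is, as \<open>l\<close> is odd, when \<open>l\<close> divides \<open>m\<close>. Hence the vectors of degree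
\<open>m \<ge> p l\<close> span a submodule \<open>M\<^sub>p\<close>.

All three claims follow from one fact: \<^emph>\<open>a submodule \<open>W\<close> of \<open>M\<close> that contains some \<open>M\<^sub>p\<close> but is not contained in
\<open>M\<^sub>1\<close> is all of \<open>M\<close>\<close> (\<open>verma_submodule_full\<close>, by way of \<open>coeff_submodule_full\<close>). Take \<open>w\<close> in \<open>W\<close> with a non-zero
coefficient in some degree \<open>m < l\<close>. As the scalars of \<open>E\<close> do not vanish in degrees \<open>1, \<dots>, m\<close>, applying \<open>E\<close> \<open>m\<close> times
gives an element with non-zero part in degree \<open>0\<close>. The eigenvalues \<open>lam1 q\<^sup>n\<close> of \<open>X\<close> on the \<open>f(0, n)\<close>,
\<open>0 \<le> n < l\<close>, are distinct, so some element of \<open>W\<close> has degree \<open>0\<close> part a multiple of a single \<open>f(0, n)\<close>. Applying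
powers of \<open>K\<close> and \<open>Y\<close> to it gives, for every \<open>j\<close> and \<open>n\<close>, an element of \<open>W\<close> that equals \<open>f(j, n)\<close> up to a scalar and terms of
degree \<open>> j\<close>. Since \<open>W\<close> contains everything of degree \<open>\<ge> p l\<close>, downward induction on \<open>j\<close> shows that it contains everything
of degree \<open>\<ge> j\<close>, and so all of \<open>M\<close>.

In \<open>Q\<^sub>p = M/M\<^sub>p\<close> the fact says that every submodule not inside \<open>M\<^sub>1/M\<^sub>p\<close> is the whole module. For \<open>p = 1\<close> this is
simplicity. For \<open>p > 1\<close> the submodule \<open>M\<^sub>1/M\<^sub>p\<close> is neither \<open>0\<close> nor everything, so \<open>Q\<^sub>p\<close> is not simple. If two submodules, or
a set of simple ones, add up to \<open>Q\<^sub>p\<close>, one of them is not inside \<open>M\<^sub>1/M\<^sub>p\<close> and is therefore \<open>Q\<^sub>p\<close> itself; so a direct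
decomposition is trivial and \<open>Q\<^sub>p\<close> is not a sum of simple modules.

To make sense of coefficients, the \<open>f(m, n)\<close> must be shown to be a basis. That they span
(\<open>fspan_UNIV\<close>) follows by moving generators past \<open>Y\<^sup>m K\<^sup>n\<close>. For independence (\<open>fspan_coords\<close>), and already for
the existence of the character of the subalgebra \<open>\<B>\<close>, no normal form theorem for the algebra is
proved. Instead the algebra acts on a concrete space of functions \<open>(m, n) \<mapsto> x m n\<close> by the formulas above; a suitable vector
\<open>cyc\<close> there is an eigenvector of \<open>\<B>\<close>, and the universal property of the induced module gives
a module homomorphism \<open>coords\<close> from \<open>M\<close> with \<open>v \<mapsto> cyc\<close>, from which the coefficients are read off.
\<close>

section \<open>Quotients of abelian groups carrying a right action\<close>

text \<open>The action on a quotient is given as a union over all representatives of a coset; since \<open>e\<close> preserves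
  \<open>H\<close>, every representative contributes the same coset.\<close>
lemma coset_action_eq:
  assumes G: "comm_group G" and H: "subgroup H G" and e: "e \<in> hom G G"
    and eH: "\<And>h. h \<in> H \<Longrightarrow> e h \<in> H" and c: "c \<in> carrier G"
  shows "(\<Union>x\<in>H #>\<^bsub>G\<^esub> c. H #>\<^bsub>G\<^esub> e x) = H #>\<^bsub>G\<^esub> e c"
proof -
  interpret G: comm_group G by fact
  interpret H: subgroup H G by fact
  have "H #>\<^bsub>G\<^esub> e x = H #>\<^bsub>G\<^esub> e c" if "x \<in> H #>\<^bsub>G\<^esub> c" for x
  proof -
    from that obtain h where h: "h \<in> H" "x = h \<otimes>\<^bsub>G\<^esub> c" by (auto simp: r_coset_def)
    then have "e x = e h \<otimes>\<^bsub>G\<^esub> e c" using hom_mult[OF e] c H.mem_carrier by blast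
    then have "e x \<in> H #>\<^bsub>G\<^esub> e c" using eH h by (auto simp: r_coset_def)
    then show ?thesis
      using G.repr_independence[OF _ _ H] hom_in_carrier[OF e c] by auto
  qed
  moreover have "c \<in> H #>\<^bsub>G\<^esub> c" by (rule G.rcos_self[OF c H])
  ultimately show ?thesis by blast
qed

text \<open>Quotient modules and induced modules are both coset spaces \<open>G/H\<close> on which the ring acts through
  endomorphisms \<open>e s\<close> of \<open>G\<close>. In the second case \<open>G\<close> is a free abelian group that is itself no module, so
  the module laws are required of \<open>e\<close> only modulo \<open>H\<close>.\<close>
lemma right_module_cosetsI:
  fixes R :: "('a, 'm) ring_scheme" and G :: "('b, 'n) monoid_scheme"
    and Q :: "('a, 'b set, 'o) rmodule_scheme"
  assumes R: "ring R" and G: "comm_group G" and H: "subgroup H G"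
    and e: "\<And>s. s \<in> carrier R \<Longrightarrow> e s \<in> hom G G"
    and eH: "\<And>s h. s \<in> carrier R \<Longrightarrow> h \<in> H \<Longrightarrow> e s h \<in> H"
    and e_add: "\<And>s t c. s \<in> carrier R \<Longrightarrow> t \<in> carrier R \<Longrightarrow> c \<in> carrier G \<Longrightarrow>
      H #>\<^bsub>G\<^esub> e (s \<oplus>\<^bsub>R\<^esub> t) c = H #>\<^bsub>G\<^esub> (e s c \<otimes>\<^bsub>G\<^esub> e t c)"
    and e_mult: "\<And>s t c. s \<in> carrier R \<Longrightarrow> t \<in> carrier R \<Longrightarrow> c \<in> carrier G \<Longrightarrow>
      H #>\<^bsub>G\<^esub> e (s \<otimes>\<^bsub>R\<^esub> t) c = H #>\<^bsub>G\<^esub> e t (e s c)"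
    and e_one: "\<And>c. c \<in> carrier G \<Longrightarrow> H #>\<^bsub>G\<^esub> e \<one>\<^bsub>R\<^esub> c = H #>\<^bsub>G\<^esub> c"
    and carr: "carrier Q = rcosets\<^bsub>G\<^esub> H" and add: "ring.add Q = set_mult G"
    and zero: "ring.zero Q = H" and act: "ract Q = (\<lambda>C s. \<Union>c\<in>C. H #>\<^bsub>G\<^esub> e s c)"
  shows "right_module R Q"
proof -
  interpret R: ring R by fact
  interpret G: comm_group G by fact
  interpret H: subgroup H G by fact
  have norm: "H \<lhd> G" using G.subgroup_imp_normal[OF H] .
  have cg: "comm_group (G Mod H)" using G.abelian_FactGroup[OF H] .
  interpret GH: comm_group "G Mod H" by fact
  have GH: "carrier (G Mod H) = carrier Q" "monoid.mult (G Mod H) = ring.add Q" "\<one>\<^bsub>G Mod H\<^esub> = \<zero>\<^bsub>Q\<^esub>"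
    by (simp_all add: FactGroup_def carr add zero)
  interpret Q: abelian_group Q
    by (rule abelian_groupI)
      (fact GH.m_closed[unfolded GH] GH.one_closed[unfolded GH] GH.m_assoc[unfolded GH]
         GH.m_comm[unfolded GH] GH.l_one[unfolded GH]
       | use GH.l_inv_ex[unfolded GH] in blast)+
  have act': "(H #>\<^bsub>G\<^esub> c) \<odot>\<^sub>r\<^bsub>Q\<^esub> s = H #>\<^bsub>G\<^esub> e s c" if "c \<in> carrier G" "s \<in> carrier R" for c s
    unfolding act using coset_action_eq[OF G H e[OF that(2)] eH[OF that(2)] that(1)] by simp
  have add': "(H #>\<^bsub>G\<^esub> c) \<oplus>\<^bsub>Q\<^esub> (H #>\<^bsub>G\<^esub> d) = H #>\<^bsub>G\<^esub> (c \<otimes>\<^bsub>G\<^esub> d)"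
    if "c \<in> carrier G" "d \<in> carrier G" for c d
    unfolding add using normal.rcos_sum[OF norm that] .
  have in_Q: "x \<in> carrier Q \<longleftrightarrow> (\<exists>c\<in>carrier G. x = H #>\<^bsub>G\<^esub> c)" for x
    by (auto simp: carr RCOSETS_def)
  have e_cl: "e s c \<in> carrier G" if "c \<in> carrier G" "s \<in> carrier R" for c s
    using hom_in_carrier[OF e] that by blast
  show ?thesis
  proof (intro right_module.intro right_module_axioms.intro R Q.abelian_group_axioms)
    show "x \<odot>\<^sub>r\<^bsub>Q\<^esub> a \<in> carrier Q" if "x \<in> carrier Q" "a \<in> carrier R" for x a
      using that act' e_cl by (auto simp: in_Q)
    show "(x \<oplus>\<^bsub>Q\<^esub> y) \<odot>\<^sub>r\<^bsub>Q\<^esub> a = x \<odot>\<^sub>r\<^bsub>Q\<^esub> a \<oplus>\<^bsub>Q\<^esub> y \<odot>\<^sub>r\<^bsub>Q\<^esub> a"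
      if "x \<in> carrier Q" "y \<in> carrier Q" "a \<in> carrier R" for x y a
      using that hom_mult[OF e] by (auto simp: in_Q act' add' e_cl)
    show "x \<odot>\<^sub>r\<^bsub>Q\<^esub> (a \<oplus>\<^bsub>R\<^esub> b) = x \<odot>\<^sub>r\<^bsub>Q\<^esub> a \<oplus>\<^bsub>Q\<^esub> x \<odot>\<^sub>r\<^bsub>Q\<^esub> b"
      if "x \<in> carrier Q" "a \<in> carrier R" "b \<in> carrier R" for x a b
      using that by (auto simp: in_Q act' add' e_cl e_add)
    show "x \<odot>\<^sub>r\<^bsub>Q\<^esub> (a \<otimes>\<^bsub>R\<^esub> b) = (x \<odot>\<^sub>r\<^bsub>Q\<^esub> a) \<odot>\<^sub>r\<^bsub>Q\<^esub> b"
      if "x \<in> carrier Q" "a \<in> carrier R" "b \<in> carrier R" for x a b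
      using that by (auto simp: in_Q act' e_cl e_mult)
    show "x \<odot>\<^sub>r\<^bsub>Q\<^esub> \<one>\<^bsub>R\<^esub> = x" if "x \<in> carrier Q" for x
      using that by (auto simp: in_Q act' e_one)
  qed
qed

section \<open>Submodules and quotient modules\<close>

context right_module
begin

lemma submoduleD:
  assumes "right_submodule N R M"
  shows "N \<subseteq> carrier M" "\<zero>\<^bsub>M\<^esub> \<in> N" "x \<in> N \<Longrightarrow> y \<in> N \<Longrightarrow> x \<oplus>\<^bsub>M\<^esub> y \<in> N"
    "x \<in> N \<Longrightarrow> \<ominus>\<^bsub>M\<^esub> x \<in> N" "x \<in> N \<Longrightarrow> y \<in> N \<Longrightarrow> x \<ominus>\<^bsub>M\<^esub> y \<in> N"
    "x \<in> N \<Longrightarrow> a \<in> carrier R \<Longrightarrow> x \<odot>\<^sub>r\<^bsub>M\<^esub> a \<in> N"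
proof -
  from assms have N: "subgroup N (add_monoid M)" and "\<forall>x\<in>N. \<forall>a\<in>carrier R. x \<odot>\<^sub>r\<^bsub>M\<^esub> a \<in> N"
    by (auto simp: right_submodule_def)
  then show "x \<in> N \<Longrightarrow> a \<in> carrier R \<Longrightarrow> x \<odot>\<^sub>r\<^bsub>M\<^esub> a \<in> N" by blast
  show "N \<subseteq> carrier M" "\<zero>\<^bsub>M\<^esub> \<in> N"
    and p: "\<And>x y. x \<in> N \<Longrightarrow> y \<in> N \<Longrightarrow> x \<oplus>\<^bsub>M\<^esub> y \<in> N" and m: "\<And>x. x \<in> N \<Longrightarrow> \<ominus>\<^bsub>M\<^esub> x \<in> N"
    using subgroup.subset[OF N] subgroup.one_closed[OF N] subgroup.m_closed[OF N]
      subgroup.m_inv_closed[OF N] by (auto simp: a_inv_def)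
  show "x \<in> N \<Longrightarrow> y \<in> N \<Longrightarrow> x \<ominus>\<^bsub>M\<^esub> y \<in> N" unfolding a_minus_def by (intro p m)
qed

lemma submoduleI:
  assumes "N \<subseteq> carrier M" "N \<noteq> {}" "\<And>x y. x \<in> N \<Longrightarrow> y \<in> N \<Longrightarrow> x \<oplus>\<^bsub>M\<^esub> y \<in> N"
    "\<And>x. x \<in> N \<Longrightarrow> \<ominus>\<^bsub>M\<^esub> x \<in> N" "\<And>x a. x \<in> N \<Longrightarrow> a \<in> carrier R \<Longrightarrow> x \<odot>\<^sub>r\<^bsub>M\<^esub> a \<in> N"
  shows "right_submodule N R M"
  unfolding right_submodule_def
proof
  show "subgroup N (add_monoid M)"
    by (rule M.add.subgroupI) (use assms in \<open>auto simp: a_inv_def\<close>)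
qed (use assms in blast)

lemma submodule_coset_eq_iff:
  assumes P: "right_submodule P R M" and "x \<in> carrier M" "y \<in> carrier M"
  shows "P +>\<^bsub>M\<^esub> x = P +>\<^bsub>M\<^esub> y \<longleftrightarrow> x \<ominus>\<^bsub>M\<^esub> y \<in> P"
proof -
  have sg: "subgroup P (add_monoid M)" using P by (simp add: right_submodule_def)
  have "P +>\<^bsub>M\<^esub> x = P +>\<^bsub>M\<^esub> y \<longleftrightarrow> x \<in> P +>\<^bsub>M\<^esub> y"
    using M.a_repr_independence'[OF _ assms(3) sg] M.add.rcos_self[OF assms(2) sg]
    by (auto simp: a_r_coset_def)
  also have "\<dots> \<longleftrightarrow> x \<ominus>\<^bsub>M\<^esub> y \<in> P"
  proof
    assume "x \<in> P +>\<^bsub>M\<^esub> y"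
    then obtain h where h: "h \<in> P" "x = h \<oplus>\<^bsub>M\<^esub> y" by (auto simp: a_r_coset_def')
    moreover have "h \<in> carrier M" using h submoduleD(1)[OF P] by blast
    ultimately show "x \<ominus>\<^bsub>M\<^esub> y \<in> P"
      using assms(3) by (simp add: a_minus_def M.a_assoc M.r_neg)
  next
    assume *: "x \<ominus>\<^bsub>M\<^esub> y \<in> P"
    have "x = (x \<ominus>\<^bsub>M\<^esub> y) \<oplus>\<^bsub>M\<^esub> y"
      using assms(2,3) by (simp add: a_minus_def M.a_assoc M.l_neg)
    then show "x \<in> P +>\<^bsub>M\<^esub> y" using * by (auto simp: a_r_coset_def')
  qed
  finally show ?thesis .
qed

lemma submodule_coset_self:
  assumes "right_submodule P R M" and "x \<in> P"
  shows "P +>\<^bsub>M\<^esub> x = P"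
  using M.add.coset_join2[of x P] assms submoduleD(1)[OF assms(1)]
  by (auto simp: right_submodule_def a_r_coset_def)

lemma ract_zero_left: "a \<in> carrier R \<Longrightarrow> \<zero>\<^bsub>M\<^esub> \<odot>\<^sub>r\<^bsub>M\<^esub> a = \<zero>\<^bsub>M\<^esub>"
  using ract_add_left[of "\<zero>\<^bsub>M\<^esub>" "\<zero>\<^bsub>M\<^esub>" a] ract_closed[of "\<zero>\<^bsub>M\<^esub>" a]
  by (metis M.add.l_cancel_one M.zero_closed M.r_zero)

lemma ract_zero_right: "x \<in> carrier M \<Longrightarrow> x \<odot>\<^sub>r\<^bsub>M\<^esub> \<zero>\<^bsub>R\<^esub> = \<zero>\<^bsub>M\<^esub>"
  using ract_add_right[of x "\<zero>\<^bsub>R\<^esub>" "\<zero>\<^bsub>R\<^esub>"] ract_closed[of x "\<zero>\<^bsub>R\<^esub>"]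
  by (metis M.add.l_cancel_one R.zero_closed R.r_zero)

lemma ract_minus_left:
  "x \<in> carrier M \<Longrightarrow> a \<in> carrier R \<Longrightarrow> (\<ominus>\<^bsub>M\<^esub> x) \<odot>\<^sub>r\<^bsub>M\<^esub> a = \<ominus>\<^bsub>M\<^esub> (x \<odot>\<^sub>r\<^bsub>M\<^esub> a)"
  using ract_add_left[of "\<ominus>\<^bsub>M\<^esub> x" x a] ract_zero_left[of a]
  by (metis M.a_inv_closed M.l_neg M.minus_equality ract_closed)

lemma quotient_module_right_module:
  assumes P: "right_submodule P R M"
  shows "right_module R (quotient_module M P)"
proof (rule right_module_cosetsI[where G = "add_monoid M" and e = "\<lambda>s x. x \<odot>\<^sub>r\<^bsub>M\<^esub> s"])
  show "ring R" by unfold_locales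
  show "comm_group (add_monoid M)" by (rule M.a_comm_group)
  show "subgroup P (add_monoid M)" using P by (simp add: right_submodule_def)
  show "(\<lambda>x. x \<odot>\<^sub>r\<^bsub>M\<^esub> s) \<in> hom (add_monoid M) (add_monoid M)" if "s \<in> carrier R" for s
    using that by (auto intro!: homI simp: ract_closed ract_add_left)
qed (use submoduleD[OF P] in
    \<open>simp_all add: quotient_module_def A_RCOSETS_def set_add_def a_r_coset_def
       ract_add_right ract_mult ract_one\<close>)

lemma quotient_map:
  assumes P: "right_submodule P R M"
  shows "carrier (quotient_module M P) = (\<lambda>x. P +>\<^bsub>M\<^esub> x) ` carrier M"
    "\<zero>\<^bsub>quotient_module M P\<^esub> = P"
    "x \<in> carrier M \<Longrightarrow> y \<in> carrier M \<Longrightarrow>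
      (P +>\<^bsub>M\<^esub> x) \<oplus>\<^bsub>quotient_module M P\<^esub> (P +>\<^bsub>M\<^esub> y) = P +>\<^bsub>M\<^esub> (x \<oplus>\<^bsub>M\<^esub> y)"
    "x \<in> carrier M \<Longrightarrow> a \<in> carrier R \<Longrightarrow>
      (P +>\<^bsub>M\<^esub> x) \<odot>\<^sub>r\<^bsub>quotient_module M P\<^esub> a = P +>\<^bsub>M\<^esub> (x \<odot>\<^sub>r\<^bsub>M\<^esub> a)"
proof -
  have sg: "subgroup P (add_monoid M)" using P by (simp add: right_submodule_def)
  show "carrier (quotient_module M P) = (\<lambda>x. P +>\<^bsub>M\<^esub> x) ` carrier M" "\<zero>\<^bsub>quotient_module M P\<^esub> = P"
    by (auto simp: quotient_module_def A_RCOSETS_def')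
  show "(P +>\<^bsub>M\<^esub> x) \<oplus>\<^bsub>quotient_module M P\<^esub> (P +>\<^bsub>M\<^esub> y) = P +>\<^bsub>M\<^esub> (x \<oplus>\<^bsub>M\<^esub> y)"
    if "x \<in> carrier M" "y \<in> carrier M"
    using normal.rcos_sum[OF comm_group.subgroup_imp_normal[OF M.a_comm_group sg], of x y] that
    by (simp add: quotient_module_def set_add_def a_r_coset_def)
  show "(P +>\<^bsub>M\<^esub> x) \<odot>\<^sub>r\<^bsub>quotient_module M P\<^esub> a = P +>\<^bsub>M\<^esub> (x \<odot>\<^sub>r\<^bsub>M\<^esub> a)"
    if "x \<in> carrier M" "a \<in> carrier R"
  proof -
    have "(\<lambda>x. x \<odot>\<^sub>r\<^bsub>M\<^esub> a) \<in> hom (add_monoid M) (add_monoid M)"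
      using that by (auto intro!: homI simp: ract_closed ract_add_left)
    from coset_action_eq[OF M.a_comm_group sg this, of x] show ?thesis
      using that submoduleD(6)[OF P] by (simp add: quotient_module_def a_r_coset_def)
  qed
qed

end

section \<open>Modules with a unique maximal submodule\<close>

lemma simple_if_submodules_trivial:
  assumes "right_module R L" and "carrier L \<noteq> {\<zero>\<^bsub>L\<^esub>}"
    and key: "\<And>W. right_submodule W R L \<Longrightarrow> \<not> W \<subseteq> {\<zero>\<^bsub>L\<^esub>} \<Longrightarrow> W = carrier L"
  shows "simple_module R L"
  unfolding simple_module_def
proof (intro conjI allI impI)
  fix N assume N: "right_submodule N R L"
  then show "N = {\<zero>\<^bsub>L\<^esub>} \<or> N = carrier L"
    using key[OF N] right_module.submoduleD(2)[OF assms(1) N] by blast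
qed (use assms in auto)

lemma local_not_simple:
  assumes "right_submodule U R L" and "U \<noteq> carrier L" and "U \<noteq> {\<zero>\<^bsub>L\<^esub>}"
  shows "\<not> simple_module R L"
  using assms by (auto simp: simple_module_def)

text \<open>Here \<open>U\<close> is a proper submodule of \<open>L\<close> that contains every other proper submodule. If all simple summands were inside \<open>U\<close>, so would be their sum; a summand outside \<open>U\<close> is \<open>L\<close>, which is
  not simple because of \<open>U\<close>.\<close>
lemma local_not_semisimple:
  assumes L: "right_module R L" and U: "right_submodule U R L"
    and "U \<noteq> carrier L" and "U \<noteq> {\<zero>\<^bsub>L\<^esub>}"
    and key: "\<And>W. right_submodule W R L \<Longrightarrow> \<not> W \<subseteq> U \<Longrightarrow> W = carrier L"
  shows "\<not> semisimple_module R L"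
proof
  interpret right_module R L by fact
  assume "semisimple_module R L"
  then obtain S where S: "\<And>N. N \<in> S \<Longrightarrow> right_submodule N R L \<and> simple_module R (L\<lparr>carrier := N\<rparr>)"
    and gen: "generate (add_monoid L) (\<Union>S) = carrier L"
    by (auto simp: semisimple_module_def)
  have "\<exists>N\<in>S. \<not> N \<subseteq> U"
  proof (rule ccontr)
    assume "\<not> (\<exists>N\<in>S. \<not> N \<subseteq> U)"
    then have "\<Union>S \<subseteq> U" by blast
    moreover have "subgroup U (add_monoid L)" using U by (simp add: right_submodule_def)
    ultimately have "generate (add_monoid L) (\<Union>S) \<subseteq> U"
      using M.add.generate_subgroup_incl by blast
    then show False using gen submoduleD(1)[OF U] \<open>U \<noteq> carrier L\<close> by auto
  qed
  then obtain N where N: "N \<in> S" "\<not> N \<subseteq> U" by blast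
  then have "N = carrier L" using S key by blast
  then have "simple_module R L" using S[OF N(1)] by simp
  then show False using local_not_simple[OF U assms(3,4)] by blast
qed

lemma local_indecomposable:
  assumes L: "right_module R L" and U: "right_submodule U R L" and "U \<noteq> carrier L"
    and key: "\<And>W. right_submodule W R L \<Longrightarrow> \<not> W \<subseteq> U \<Longrightarrow> W = carrier L"
  shows "indecomposable_module R L"
  unfolding indecomposable_module_def
proof (intro conjI allI impI)
  interpret right_module R L by fact
  show "right_module R L" by fact
  show "carrier L \<noteq> {\<zero>\<^bsub>L\<^esub>}" using submoduleD(1,2)[OF U] \<open>U \<noteq> carrier L\<close> by auto
  fix N N'
  assume A: "right_submodule N R L \<and> right_submodule N' R L \<and>
             N <+>\<^bsub>L\<^esub> N' = carrier L \<and> N \<inter> N' = {\<zero>\<^bsub>L\<^esub>}"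
  have "\<not> (N \<subseteq> U \<and> N' \<subseteq> U)"
  proof
    assume "N \<subseteq> U \<and> N' \<subseteq> U"
    then have "N <+>\<^bsub>L\<^esub> N' \<subseteq> U" using submoduleD(3)[OF U] by (auto simp: set_add_def')
    then show False using A submoduleD(1)[OF U] \<open>U \<noteq> carrier L\<close> by auto
  qed
  then have "N = carrier L \<or> N' = carrier L" using A key by blast
  then show "N = {\<zero>\<^bsub>L\<^esub>} \<or> N' = {\<zero>\<^bsub>L\<^esub>}"
    using A submoduleD(1)[of N] submoduleD(1)[of N'] by auto
qed

text \<open>A submodule of \<open>M/P\<close> pulls back to a submodule of \<open>M\<close> that contains \<open>P\<close>. So it suffices to
  control the submodules of \<open>M\<close> above \<open>P\<close> in order to know that \<open>U/P\<close> is the unique maximal submodule of \<open>M/P\<close>.\<close>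
lemma quotient_local:
  assumes M: "right_module R M" and P: "right_submodule P R M" and U: "right_submodule U R M"
    and PU: "P \<subseteq> U" and Un: "U \<noteq> carrier M"
    and key: "\<And>W. right_submodule W R M \<Longrightarrow> P \<subseteq> W \<Longrightarrow> \<not> W \<subseteq> U \<Longrightarrow> W = carrier M"
  defines "L \<equiv> quotient_module M P" and "U' \<equiv> (\<lambda>x. P +>\<^bsub>M\<^esub> x) ` U"
  shows "right_submodule U' R L" "U' \<noteq> carrier L"
    "\<And>W. right_submodule W R L \<Longrightarrow> \<not> W \<subseteq> U' \<Longrightarrow> W = carrier L"
    "U' = {\<zero>\<^bsub>L\<^esub>} \<longleftrightarrow> U = P"
proof -
  interpret right_module R M by fact
  interpret L: right_module R L unfolding L_def by (rule quotient_module_right_module[OF P])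
  note q = quotient_map[OF P, folded L_def]
  note Uc = submoduleD[OF U] and Pc = submoduleD[OF P]
  have qm: "\<ominus>\<^bsub>L\<^esub> (P +>\<^bsub>M\<^esub> x) = P +>\<^bsub>M\<^esub> (\<ominus>\<^bsub>M\<^esub> x)" if x: "x \<in> carrier M" for x
  proof (rule L.M.minus_equality)
    have "P +>\<^bsub>M\<^esub> \<zero>\<^bsub>M\<^esub> = P" using submodule_coset_self[OF P Pc(2)] .
    then show "(P +>\<^bsub>M\<^esub> (\<ominus>\<^bsub>M\<^esub> x)) \<oplus>\<^bsub>L\<^esub> (P +>\<^bsub>M\<^esub> x) = \<zero>\<^bsub>L\<^esub>" using x by (simp add: q M.l_neg)
  qed (use x in \<open>auto simp: q\<close>)
  have inU: "x \<in> U" if "x \<in> carrier M" "P +>\<^bsub>M\<^esub> x \<in> U'" for x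
  proof -
    from that obtain u where u: "u \<in> U" "P +>\<^bsub>M\<^esub> x = P +>\<^bsub>M\<^esub> u" by (auto simp: U'_def)
    then have "x \<ominus>\<^bsub>M\<^esub> u \<in> U" using submodule_coset_eq_iff[OF P that(1), of u] Uc(1) PU by blast
    then have "x \<ominus>\<^bsub>M\<^esub> u \<oplus>\<^bsub>M\<^esub> u \<in> U" using Uc u by blast
    moreover have "x \<ominus>\<^bsub>M\<^esub> u \<oplus>\<^bsub>M\<^esub> u = x"
      using that u Uc(1) by (auto simp: a_minus_def M.a_assoc M.l_neg)
    ultimately show ?thesis by simp
  qed
  show "right_submodule U' R L"
  proof (rule L.submoduleI)
    show "U' \<subseteq> carrier L" using Uc by (auto simp: U'_def q)
    show "U' \<noteq> {}" using Uc by (auto simp: U'_def)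
    show "x \<oplus>\<^bsub>L\<^esub> y \<in> U'" if "x \<in> U'" "y \<in> U'" for x y
      using that Uc(1,3) by (auto simp: U'_def q subset_iff)
    show "\<ominus>\<^bsub>L\<^esub> x \<in> U'" if "x \<in> U'" for x
      using that Uc(1,4) by (auto simp: U'_def qm subset_iff)
    show "x \<odot>\<^sub>r\<^bsub>L\<^esub> a \<in> U'" if "x \<in> U'" "a \<in> carrier R" for x a
      using that Uc(1,6) by (auto simp: U'_def q subset_iff)
  qed
  show "U' \<noteq> carrier L"
  proof
    assume "U' = carrier L"
    then have "x \<in> U" if "x \<in> carrier M" for x using that by (intro inU) (auto simp: q)
    then show False using Uc(1) Un by blast
  qed
  show "W = carrier L" if W: "right_submodule W R L" and nW: "\<not> W \<subseteq> U'" for W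
  proof -
    note Wc = L.submoduleD[OF W]
    define W0 where "W0 = {x \<in> carrier M. P +>\<^bsub>M\<^esub> x \<in> W}"
    note P0 = submodule_coset_self[OF P]
    have W0: "right_submodule W0 R M"
    proof (rule submoduleI)
      show "W0 \<subseteq> carrier M" by (auto simp: W0_def)
      show "W0 \<noteq> {}" using Wc(2) P0[OF Pc(2)] by (auto simp: W0_def q intro!: exI[of _ "\<zero>\<^bsub>M\<^esub>"])
      show "x \<oplus>\<^bsub>M\<^esub> y \<in> W0" if "x \<in> W0" "y \<in> W0" for x y
        using that Wc(3)[of "P +>\<^bsub>M\<^esub> x" "P +>\<^bsub>M\<^esub> y"] by (auto simp: W0_def q)
      show "\<ominus>\<^bsub>M\<^esub> x \<in> W0" if "x \<in> W0" for x
        using that Wc(4)[of "P +>\<^bsub>M\<^esub> x"] by (auto simp: W0_def qm)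
      show "x \<odot>\<^sub>r\<^bsub>M\<^esub> a \<in> W0" if "x \<in> W0" "a \<in> carrier R" for x a
        using that Wc(6)[of "P +>\<^bsub>M\<^esub> x" a] by (auto simp: W0_def q ract_closed)
    qed
    have "P \<subseteq> W0" using P0 Pc(1) Wc(2) by (auto simp: W0_def q)
    moreover obtain C where "C \<in> W" "C \<notin> U'" using nW by blast
    then obtain x where "x \<in> carrier M" "P +>\<^bsub>M\<^esub> x \<in> W" "P +>\<^bsub>M\<^esub> x \<notin> U'" using Wc(1) by (auto simp: q)
    then have "\<not> W0 \<subseteq> U" by (auto simp: W0_def U'_def)
    ultimately have "W0 = carrier M" using key[OF W0] by blast
    then show ?thesis using Wc(1) by (auto simp: W0_def q)
  qed
  show "U' = {\<zero>\<^bsub>L\<^esub>} \<longleftrightarrow> U = P"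
  proof
    assume U': "U' = {\<zero>\<^bsub>L\<^esub>}"
    have "u \<in> P" if "u \<in> U" for u
    proof -
      have "P +>\<^bsub>M\<^esub> u = P" using that U' by (auto simp: U'_def q)
      moreover have "u \<in> P +>\<^bsub>M\<^esub> u"
        using M.add.rcos_self[of u P] that Uc(1) P by (auto simp: right_submodule_def a_r_coset_def)
      ultimately show ?thesis by simp
    qed
    then show "U = P" using PU by blast
  next
    assume "U = P"
    then show "U' = {\<zero>\<^bsub>L\<^esub>}"
      using Pc(2) submodule_coset_self[OF P] by (auto simp: U'_def q)
  qed
qed

section \<open>Induced modules\<close>

locale induced = S: ring S + N: right_module R N
  for R :: "('a, 'k) ring_scheme" and S :: "('a, 'm) ring_scheme"
    and N :: "('a, 'b, 'n) rmodule_scheme" +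
  assumes RS: "carrier R \<subseteq> carrier S"
begin

abbreviation "F \<equiv> tensor_free S N"
abbreviation "H \<equiv> tensor_kernel R S N"
abbreviation "I \<equiv> induced_module R S N"
abbreviation "pt \<equiv> pure_tensor R S N"
abbreviation "act_free s \<equiv> frag_extend (\<lambda>(x, t). frag_of (x, t \<otimes>\<^bsub>S\<^esub> s))"

lemma comm_group_F: "comm_group F"
  by (simp add: tensor_free_def abelian_free_Abelian_group)

sublocale F: comm_group F by (rule comm_group_F)

lemma F_simps [simp]:
  "c \<in> carrier F \<longleftrightarrow> Poly_Mapping.keys c \<subseteq> carrier N \<times> carrier S"
  "\<one>\<^bsub>F\<^esub> = 0" "c \<otimes>\<^bsub>F\<^esub> d = c + d"
  by (simp_all add: tensor_free_def)

lemma F_inv: "c \<in> carrier F \<Longrightarrow> inv\<^bsub>F\<^esub> c = - c"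
  by (simp add: tensor_free_def)

lemma F_closed: "c \<in> carrier F \<Longrightarrow> d \<in> carrier F \<Longrightarrow> c + d \<in> carrier F"
  "c \<in> carrier F \<Longrightarrow> d \<in> carrier F \<Longrightarrow> c - d \<in> carrier F"
  "x \<in> carrier N \<Longrightarrow> s \<in> carrier S \<Longrightarrow> frag_of (x, s) \<in> carrier F"
  using keys_add[of c d] keys_diff[of c d] by auto

lemma F_induct [consumes 1, case_names zero diff pure]:
  assumes "c \<in> carrier F" and "P 0"
    and "\<And>c d. c \<in> carrier F \<Longrightarrow> d \<in> carrier F \<Longrightarrow> P c \<Longrightarrow> P d \<Longrightarrow> P (c - d)"
    and "\<And>x s. x \<in> carrier N \<Longrightarrow> s \<in> carrier S \<Longrightarrow> P (frag_of (x, s))"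
  shows "P c"
  by (rule free_Abelian_group_induct[of c "carrier N \<times> carrier S"]) (use assms in auto)

lemma rels_in_F: "tensor_rels R S N \<subseteq> carrier F"
proof
  fix c assume "c \<in> tensor_rels R S N"
  then show "c \<in> carrier F"
    unfolding tensor_rels_def using RS
    by (elim UnE CollectE exE conjE)
      (simp del: F_simps, intro F_closed N.M.add.m_closed S.add.m_closed S.m_closed N.ract_closed; auto)+
qed

lemma subgroup_H: "subgroup H F"
  unfolding tensor_kernel_def by (rule F.generate_is_subgroup[OF rels_in_F])

lemma H_closed: "0 \<in> H" "c \<in> H \<Longrightarrow> d \<in> H \<Longrightarrow> c + d \<in> H" "c \<in> H \<Longrightarrow> - c \<in> H"
  "c \<in> H \<Longrightarrow> d \<in> H \<Longrightarrow> c - d \<in> H" "c \<in> H \<Longrightarrow> c \<in> carrier F"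
proof -
  show "0 \<in> H" and c: "\<And>c d. c \<in> H \<Longrightarrow> d \<in> H \<Longrightarrow> c + d \<in> H"
    and m: "\<And>c. c \<in> H \<Longrightarrow> c \<in> carrier F"
    using subgroup.one_closed[OF subgroup_H] subgroup.m_closed[OF subgroup_H]
      subgroup.mem_carrier[OF subgroup_H] by simp_all
  show i: "- c \<in> H" if "c \<in> H" for c
    using subgroup.m_inv_closed[OF subgroup_H that] F_inv[OF m[OF that]] by simp
  show "c - d \<in> H" if "c \<in> H" "d \<in> H" using c[OF that(1) i[OF that(2)]] by simp
qed

lemma coset_eqI:
  assumes "c \<in> carrier F" "d \<in> carrier F" "c - d \<in> H"
  shows "H #>\<^bsub>F\<^esub> c = H #>\<^bsub>F\<^esub> d"
proof -
  have "c = (c - d) \<otimes>\<^bsub>F\<^esub> d" by simp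
  then have "c \<in> H #>\<^bsub>F\<^esub> d" using assms(3) unfolding r_coset_def by blast
  then show ?thesis using F.repr_independence[OF _ assms(2) subgroup_H] by simp
qed

lemma act_free_hom: "s \<in> carrier S \<Longrightarrow> act_free s \<in> hom F F"
  by (rule homI) (use keys_frag_extend[of "\<lambda>(x, t). frag_of (x, t \<otimes>\<^bsub>S\<^esub> s)"]
      in \<open>fastforce simp: frag_extend_add\<close>)+

text \<open>Right multiplication on the ring factor turns each defining relation of the tensor product into
  a relation of the same kind.\<close>
lemma act_free_rels:
  assumes s: "s \<in> carrier S" and c: "c \<in> tensor_rels R S N"
  shows "act_free s c \<in> H"
proof -
  have "act_free s c \<in> tensor_rels R S N"
    using c unfolding tensor_rels_def
  proof (elim UnE CollectE exE conjE, goal_cases)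
    case (1 x y t)
    then have "act_free s c = frag_of (x \<oplus>\<^bsub>N\<^esub> y, t \<otimes>\<^bsub>S\<^esub> s) - frag_of (x, t \<otimes>\<^bsub>S\<^esub> s) - frag_of (y, t \<otimes>\<^bsub>S\<^esub> s)"
      by (simp add: frag_extend_diff)
    then show ?case using 1 s by blast
  next
    case (2 x t u)
    then have "act_free s c = frag_of (x, t \<otimes>\<^bsub>S\<^esub> s \<oplus>\<^bsub>S\<^esub> u \<otimes>\<^bsub>S\<^esub> s) - frag_of (x, t \<otimes>\<^bsub>S\<^esub> s) - frag_of (x, u \<otimes>\<^bsub>S\<^esub> s)"
      using s by (simp add: frag_extend_diff S.l_distr)
    then show ?case using 2 s by blast
  next
    case (3 x r t)
    then have "act_free s c = frag_of (x \<odot>\<^sub>r\<^bsub>N\<^esub> r, t \<otimes>\<^bsub>S\<^esub> s) - frag_of (x, r \<otimes>\<^bsub>S\<^esub> (t \<otimes>\<^bsub>S\<^esub> s))"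
      using s RS by (simp add: frag_extend_diff S.m_assoc subset_iff)
    then show ?case using 3 s by blast
  qed
  then show ?thesis unfolding tensor_kernel_def by (rule generate.incl)
qed

lemma act_free_H:
  assumes s: "s \<in> carrier S" and c: "c \<in> H"
  shows "act_free s c \<in> H"
  using c unfolding tensor_kernel_def[of R S N]
proof (induction rule: generate.induct)
  case one
  then show ?case using H_closed by (simp add: tensor_kernel_def)
next
  case (incl h)
  then show ?case using act_free_rels[OF s] by (simp add: tensor_kernel_def)
next
  case (inv h)
  then show ?case using act_free_rels[OF s, of h] H_closed(3) F_inv rels_in_F
    by (auto simp: tensor_kernel_def frag_extend_minus)
next
  case (eng h1 h2)
  then show ?case using H_closed(2) by (simp add: tensor_kernel_def frag_extend_add)
qed

lemma act_free_add_rel: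
  assumes s: "s \<in> carrier S" "t \<in> carrier S" and c: "c \<in> carrier F"
  shows "act_free (s \<oplus>\<^bsub>S\<^esub> t) c - (act_free s c + act_free t c) \<in> H"
  using c
proof (induction c rule: F_induct)
  case (diff x y)
  have "act_free (s \<oplus>\<^bsub>S\<^esub> t) (x - y) - (act_free s (x - y) + act_free t (x - y)) =
    (act_free (s \<oplus>\<^bsub>S\<^esub> t) x - (act_free s x + act_free t x)) -
    (act_free (s \<oplus>\<^bsub>S\<^esub> t) y - (act_free s y + act_free t y))"
    by (simp add: frag_extend_diff)
  with diff show ?case using H_closed(4) by metis
next
  case (pure x u)
  have "frag_of (x, u \<otimes>\<^bsub>S\<^esub> s \<oplus>\<^bsub>S\<^esub> u \<otimes>\<^bsub>S\<^esub> t) - frag_of (x, u \<otimes>\<^bsub>S\<^esub> s) - frag_of (x, u \<otimes>\<^bsub>S\<^esub> t)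
    \<in> tensor_rels R S N"
    unfolding tensor_rels_def using pure s by blast
  then show ?case unfolding tensor_kernel_def
    by (intro generate.incl) (use pure s in \<open>simp add: S.r_distr diff_diff_eq\<close>)
qed (simp add: H_closed)

lemma act_free_mult:
  assumes s: "s \<in> carrier S" "t \<in> carrier S" and c: "c \<in> carrier F"
  shows "act_free (s \<otimes>\<^bsub>S\<^esub> t) c = act_free t (act_free s c)"
  using c by (induction c rule: F_induct) (use s in \<open>simp_all add: frag_extend_diff S.m_assoc\<close>)

lemma act_free_one:
  assumes c: "c \<in> carrier F"
  shows "act_free \<one>\<^bsub>S\<^esub> c = c"
  using c by (induction c rule: F_induct) (simp_all add: frag_extend_diff)

lemma I_simps:
  "carrier I = rcosets\<^bsub>F\<^esub> H" "\<zero>\<^bsub>I\<^esub> = H" "ring.add I = set_mult F"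
  "ract I = (\<lambda>C s. \<Union>c\<in>C. H #>\<^bsub>F\<^esub> act_free s c)"
  by (simp_all add: induced_module_def Let_def FactGroup_def)

lemma act_free_closed: "s \<in> carrier S \<Longrightarrow> c \<in> carrier F \<Longrightarrow> act_free s c \<in> carrier F"
  using hom_in_carrier[OF act_free_hom] by blast

lemma right_module_I: "right_module S I"
proof (rule right_module_cosetsI[where G = F and H = H and e = act_free])
  fix s t c assume st: "s \<in> carrier S" "t \<in> carrier S" and c: "c \<in> carrier F"
  show "H #>\<^bsub>F\<^esub> act_free (s \<oplus>\<^bsub>S\<^esub> t) c = H #>\<^bsub>F\<^esub> (act_free s c \<otimes>\<^bsub>F\<^esub> act_free t c)"
    by (rule coset_eqI)
      (use st c act_free_add_rel in \<open>simp_all del: F_simps add: F_simps(3) F_closed act_free_closed\<close>)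
  show "H #>\<^bsub>F\<^esub> act_free (s \<otimes>\<^bsub>S\<^esub> t) c = H #>\<^bsub>F\<^esub> act_free t (act_free s c)"
    using act_free_mult[OF st c] by simp
qed (use act_free_one in \<open>auto simp del: F_simps simp: I_simps S.ring_axioms comm_group_F subgroup_H
     act_free_hom act_free_H\<close>)

sublocale I: right_module S I by (rule right_module_I)

lemma pt_eq: "pt x s = H #>\<^bsub>F\<^esub> frag_of (x, s)" by (simp add: pure_tensor_def)

lemma I_add: "c \<in> carrier F \<Longrightarrow> d \<in> carrier F \<Longrightarrow>
    (H #>\<^bsub>F\<^esub> c) \<oplus>\<^bsub>I\<^esub> (H #>\<^bsub>F\<^esub> d) = H #>\<^bsub>F\<^esub> (c + d)"
  using normal.rcos_sum[OF F.subgroup_imp_normal[OF subgroup_H], of c d] by (simp add: I_simps)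

lemma pt_closed: "x \<in> carrier N \<Longrightarrow> s \<in> carrier S \<Longrightarrow> pt x s \<in> carrier I"
  by (auto simp: pt_eq I_simps RCOSETS_def keys_frag_of)

lemma pt_act:
  assumes "x \<in> carrier N" "t \<in> carrier S" "s \<in> carrier S"
  shows "pt x t \<odot>\<^sub>r\<^bsub>I\<^esub> s = pt x (t \<otimes>\<^bsub>S\<^esub> s)"
  using coset_action_eq[OF comm_group_F subgroup_H act_free_hom[OF assms(3)] act_free_H[OF assms(3)],
      of "frag_of (x, t)"] assms
  by (simp add: pt_eq I_simps)

lemma pt_balanced:
  assumes "x \<in> carrier N" "r \<in> carrier R" "s \<in> carrier S"
  shows "pt (x \<odot>\<^sub>r\<^bsub>N\<^esub> r) s = pt x (r \<otimes>\<^bsub>S\<^esub> s)"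
proof -
  have "frag_of (x \<odot>\<^sub>r\<^bsub>N\<^esub> r, s) - frag_of (x, r \<otimes>\<^bsub>S\<^esub> s) \<in> tensor_rels R S N"
    unfolding tensor_rels_def using assms by blast
  then have "frag_of (x \<odot>\<^sub>r\<^bsub>N\<^esub> r, s) - frag_of (x, r \<otimes>\<^bsub>S\<^esub> s) \<in> H"
    unfolding tensor_kernel_def by (rule generate.incl)
  then show ?thesis unfolding pt_eq using assms RS
    by (intro coset_eqI F_closed) (auto simp: N.ract_closed)
qed

text \<open>An induced module is generated, as an abelian group, by the pure tensors.\<close>
lemma I_induct [consumes 1, case_names zero pure diff]:
  assumes "C \<in> carrier I" and "P \<zero>\<^bsub>I\<^esub>"
    and "\<And>x s. x \<in> carrier N \<Longrightarrow> s \<in> carrier S \<Longrightarrow> P (pt x s)"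
    and "\<And>C D. C \<in> carrier I \<Longrightarrow> D \<in> carrier I \<Longrightarrow> P C \<Longrightarrow> P D \<Longrightarrow> P (C \<ominus>\<^bsub>I\<^esub> D)"
  shows "P C"
proof -
  obtain c where c: "c \<in> carrier F" and C: "C = H #>\<^bsub>F\<^esub> c"
    using assms(1) by (auto simp: I_simps RCOSETS_def)
  from c have "P (H #>\<^bsub>F\<^esub> c)"
  proof (induction c rule: F_induct)
    case zero
    have "H #>\<^bsub>F\<^esub> 0 = H" using F.coset_join2[OF _ subgroup_H, of 0] H_closed(1) by simp
    then show ?case using assms(2) by (simp add: I_simps)
  next
    case (diff x y)
    then have xy: "x \<in> carrier F" "y \<in> carrier F" by auto
    then have xy': "H #>\<^bsub>F\<^esub> x \<in> carrier I" "H #>\<^bsub>F\<^esub> y \<in> carrier I" "H #>\<^bsub>F\<^esub> (x - y) \<in> carrier I"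
      using F_closed(2) by (auto simp: I_simps RCOSETS_def)
    have "(H #>\<^bsub>F\<^esub> (x - y)) \<oplus>\<^bsub>I\<^esub> (H #>\<^bsub>F\<^esub> y) = H #>\<^bsub>F\<^esub> x"
      using I_add[OF F_closed(2)[OF xy] xy(2)] by simp
    then have "H #>\<^bsub>F\<^esub> (x - y) = (H #>\<^bsub>F\<^esub> x) \<ominus>\<^bsub>I\<^esub> (H #>\<^bsub>F\<^esub> y)"
      using xy' by (metis I.M.add.inv_solve_right a_minus_def)
    then show ?case using assms(4)[OF xy'(1,2)] diff by simp
  next
    case (pure x s)
    then show ?case using assms(3) by (auto simp: pt_eq)
  qed
  then show ?thesis by (simp add: C)
qed

text \<open>The target is an abelian group given by a type class, which is enough for homomorphisms into spaces of functions.\<close>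
lemma induced_universal:
  fixes \<beta> :: "'b \<Rightarrow> 'a \<Rightarrow> 'v::ab_group_add"
  assumes "\<And>x y s. x \<in> carrier N \<Longrightarrow> y \<in> carrier N \<Longrightarrow> s \<in> carrier S \<Longrightarrow>
      \<beta> (x \<oplus>\<^bsub>N\<^esub> y) s = \<beta> x s + \<beta> y s"
    and "\<And>x s t. x \<in> carrier N \<Longrightarrow> s \<in> carrier S \<Longrightarrow> t \<in> carrier S \<Longrightarrow>
      \<beta> x (s \<oplus>\<^bsub>S\<^esub> t) = \<beta> x s + \<beta> x t"
    and "\<And>x r s. x \<in> carrier N \<Longrightarrow> r \<in> carrier R \<Longrightarrow> s \<in> carrier S \<Longrightarrow>
      \<beta> (x \<odot>\<^sub>r\<^bsub>N\<^esub> r) s = \<beta> x (r \<otimes>\<^bsub>S\<^esub> s)"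
  obtains \<phi> where "\<And>C D. C \<in> carrier I \<Longrightarrow> D \<in> carrier I \<Longrightarrow> \<phi> (C \<oplus>\<^bsub>I\<^esub> D) = \<phi> C + \<phi> D"
    and "\<And>x s. x \<in> carrier N \<Longrightarrow> s \<in> carrier S \<Longrightarrow> \<phi> (pt x s) = \<beta> x s"
proof -
  define V :: "'v monoid" where "V = \<lparr>carrier = UNIV, monoid.mult = (+), one = 0\<rparr>"
  have V: "comm_group V"
    by (rule comm_groupI) (auto simp: V_def ac_simps intro: exI[of _ "- _"] left_minus)
  then interpret V: comm_group V .
  obtain h where h: "h \<in> hom F V"
    and h_of: "\<And>z. z \<in> carrier N \<times> carrier S \<Longrightarrow> h (frag_of z) = (case z of (x, s) \<Rightarrow> \<beta> x s)"
    using V.free_Abelian_group_universal[of "\<lambda>(x, s). \<beta> x s" "carrier N \<times> carrier S"]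
    by (auto simp: tensor_free_def V_def)
  have h_add: "h (c + d) = h c + h d" if "c \<in> carrier F" "d \<in> carrier F" for c d
    using hom_mult[OF h that] by (simp add: V_def)
  have h_diff: "h (c - d) = h c - h d" if "c \<in> carrier F" "d \<in> carrier F" for c d
    using h_add[OF F_closed(2)[OF that] that(2)] by (simp add: algebra_simps)
  have h0: "h 0 = 0" using h_add[of 0 0] by simp
  have h_rels: "h c = 0" if "c \<in> tensor_rels R S N" for c
    using that unfolding tensor_rels_def using RS
    by (elim UnE CollectE exE conjE)
      (simp del: F_simps, subst h_diff h_of,
        (intro F_closed N.M.add.m_closed S.add.m_closed S.m_closed N.ract_closed; auto)+,
        simp add: h_diff h_of assms N.ract_closed subset_iff F_closed del: F_simps)+
  have h_H: "h c = 0" if "c \<in> H" for c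
    using that unfolding tensor_kernel_def
  proof (induction rule: generate.induct)
    case (inv c)
    then have "c \<in> carrier F" using rels_in_F by blast
    then show ?case using h_rels[OF inv] h_diff[of 0 c] F_inv[of c] h0 by simp
  next
    case (eng c d)
    then have "c \<in> carrier F" "d \<in> carrier F"
      using H_closed(5) unfolding tensor_kernel_def by blast+
    then show ?case using eng h_add by simp
  qed (use h_rels h0 in auto)
  obtain \<phi> where \<phi>: "\<phi> \<in> hom (F Mod H) V" "\<And>c. c \<in> carrier F \<Longrightarrow> \<phi> (H #>\<^bsub>F\<^esub> c) = h c"
  proof (rule FactGroup_universal[OF h F.subgroup_imp_normal[OF subgroup_H]])
    fix c d assume cd: "c \<in> carrier F" "d \<in> carrier F" "H #>\<^bsub>F\<^esub> c = H #>\<^bsub>F\<^esub> d"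
    then have "c \<in> H #>\<^bsub>F\<^esub> d" using F.rcos_self[OF cd(1) subgroup_H] by simp
    then obtain k where "k \<in> H" "c = k + d" by (auto simp: r_coset_def)
    then show "h c = h d" using h_add[of k d] h_H H_closed(5) cd by simp
  qed blast
  show thesis
  proof (rule that)
    show "\<phi> (C \<oplus>\<^bsub>I\<^esub> D) = \<phi> C + \<phi> D" if "C \<in> carrier I" "D \<in> carrier I" for C D
      using hom_mult[OF \<phi>(1), of C D] that by (simp add: I_simps FactGroup_def V_def)
    show "\<phi> (pt x s) = \<beta> x s" if "x \<in> carrier N" "s \<in> carrier S" for x s
      using that h_of[of "(x, s)"] \<phi>(2)[of "frag_of (x, s)"] by (simp add: pt_eq)
  qed
qed

end

section \<open>Right actions of free algebras\<close>

lemma free_alg_induct [case_names zero single add]: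
  fixes a :: "'w \<Rightarrow>\<^sub>0 'k::comm_monoid_add"
  assumes "P 0" and "\<And>w c. P (Poly_Mapping.single w c)" and "\<And>a b. P a \<Longrightarrow> P b \<Longrightarrow> P (a + b)"
  shows "P a"
proof (induction a rule: update_induct)
  case const
  show ?case by (rule assms(1))
next
  case (update f w c)
  have "Poly_Mapping.update w c f = f + Poly_Mapping.single w c"
    by (rule poly_mapping_eqI)
      (use update.hyps in \<open>auto simp: lookup_update lookup_add lookup_single in_keys_iff when_def\<close>)
  then show ?case using assms(2,3) update.IH by simp
qed

text \<open>An arbitrary family of linear maps, one for each generator, extends to a right action of the free
  algebra: words act by applying their letters from left to right.\<close>
locale letter_action = vector_space scale
  for scale :: "'k::field \<Rightarrow> 'v::ab_group_add \<Rightarrow> 'v" +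
  fixes step :: "'g \<Rightarrow> 'v \<Rightarrow> 'v"
  assumes step_add: "step g (x + y) = step g x + step g y"
    and step_scale: "step g (scale c x) = scale c (step g x)"
begin

definition word_act :: "'v \<Rightarrow> 'g free_word \<Rightarrow> 'v" where
  "word_act x w = fold step (letters w) x"

definition act :: "'v \<Rightarrow> ('g, 'k) free_alg \<Rightarrow> 'v" where
  "act x a = (\<Sum>w\<in>Poly_Mapping.keys a. scale (Poly_Mapping.lookup a w) (word_act x w))"

lemma word_act_plus: "word_act x (u + w) = word_act (word_act x u) w"
  by (simp add: word_act_def plus_free_word_def)

lemma word_act_add: "word_act (x + y) w = word_act x w + word_act y w"
proof -
  have "fold step gs (x + y) = fold step gs x + fold step gs y" for gs
    by (induction gs arbitrary: x y) (simp_all add: step_add)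
  then show ?thesis by (simp add: word_act_def)
qed

lemma word_act_scale: "word_act (scale c x) w = scale c (word_act x w)"
proof -
  have "fold step gs (scale c x) = scale c (fold step gs x)" for gs
    by (induction gs arbitrary: x) (simp_all add: step_scale)
  then show ?thesis by (simp add: word_act_def)
qed

lemma act_eq_sum_superset:
  "finite A \<Longrightarrow> Poly_Mapping.keys a \<subseteq> A \<Longrightarrow>
    act x a = (\<Sum>w\<in>A. scale (Poly_Mapping.lookup a w) (word_act x w))"
  unfolding act_def by (rule sum.mono_neutral_left) (auto simp: in_keys_iff)

lemma act_zero [simp]: "act x 0 = 0"
  by (simp add: act_def)

lemma act_add: "act x (a + b) = act x a + act x b"
proof -
  let ?A = "Poly_Mapping.keys a \<union> Poly_Mapping.keys b"
  have "finite ?A" "Poly_Mapping.keys (a + b) \<subseteq> ?A" using keys_add[of a b] by auto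
  then show ?thesis
    by (simp add: act_eq_sum_superset[of ?A] lookup_add scale_left_distrib sum.distrib)
qed

lemma act_minus: "act x (- a) = - act x a"
  using act_add[of x a "- a"] by (simp add: eq_neg_iff_add_eq_0 add.commute)

lemma act_diff: "act x (a - b) = act x a - act x b"
  using act_add[of x a "- b"] by (simp add: act_minus)

lemma act_single: "act x (Poly_Mapping.single w c) = scale c (word_act x w)"
  by (subst act_eq_sum_superset[of "{w}"]) auto

lemma act_add_left: "act (x + y) a = act x a + act y a"
  by (simp add: act_def word_act_add scale_right_distrib sum.distrib)

lemma act_scale_left: "act (scale c x) a = scale c (act x a)"
  by (simp add: act_def word_act_scale scale_sum_right mult.commute)

lemma act_zero_left [simp]: "act 0 a = 0"
  using act_scale_left[of 0 0 a] by simp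

lemma act_mult: "act x (a * b) = act (act x a) b"
proof (induction a rule: free_alg_induct)
  case (single u c)
  show ?case
  proof (induction b rule: free_alg_induct)
    case (single w d)
    show ?case
      by (simp add: mult_single act_single word_act_plus word_act_scale mult.commute)
  qed (simp_all add: act_add distrib_left)
qed (simp_all add: act_add act_add_left distrib_right)

lemma act_const [simp]: "act x (const c) = scale c x"
  by (simp add: const_def act_single word_act_def zero_free_word_def)

lemma act_one [simp]: "act x 1 = x"
  using act_const[of x 1] by (simp add: const_def)

lemma act_letter [simp]: "act x (letter g) = step g x"
  by (simp add: letter_def act_single word_act_def)

text \<open>The elements that act as zero form a two-sided ideal; so the action descends to the algebra presented
  by relations \<open>A\<close> as soon as these act as zero.\<close>
lemma act_genideal:
  assumes "\<And>x a. a \<in> A \<Longrightarrow> act x a = 0" and "a \<in> genideal free_algebra A"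
  shows "act x a = 0"
proof -
  let ?I = "{a. \<forall>x. act x a = 0}"
  have "ideal ?I free_algebra"
  proof (rule idealI[OF ring_free_algebra])
    show "subgroup ?I (add_monoid free_algebra)"
    proof (rule group.subgroupI[OF abelian_group.a_group[OF ring.is_abelian_group[OF ring_free_algebra]]])
      fix a :: "('g, 'k) free_alg" assume "a \<in> ?I"
      moreover have "inv\<^bsub>add_monoid free_algebra\<^esub> a = - a"
        by (rule group.inv_equality[OF abelian_group.a_group[OF ring.is_abelian_group[OF ring_free_algebra]]])
          (simp_all add: free_algebra_def)
      ultimately show "inv\<^bsub>add_monoid free_algebra\<^esub> a \<in> ?I" by (simp add: act_minus)
    qed (auto simp: free_algebra_def act_add intro!: exI[of _ 0])
  qed (auto simp: free_algebra_def act_mult)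
  then have "genideal free_algebra A \<subseteq> ?I"
    by (rule ring.genideal_minimal[OF ring_free_algebra]) (use assms(1) in auto)
  then show ?thesis using assms(2) by blast
qed

lemma act_invariant:
  assumes "0 \<in> U" "\<And>x y. x \<in> U \<Longrightarrow> y \<in> U \<Longrightarrow> x + y \<in> U" "\<And>c x. x \<in> U \<Longrightarrow> scale c x \<in> U"
    and "\<And>g x. x \<in> U \<Longrightarrow> step g x \<in> U" and "x \<in> U"
  shows "act x a \<in> U"
proof (induction a rule: free_alg_induct)
  case (single w c)
  have "fold step gs x \<in> U" for gs
    using assms(5) by (induction gs arbitrary: x) (auto intro: assms(4))
  then show ?case by (simp add: act_single word_act_def assms(3))
qed (simp_all add: assms act_add)

end

section \<open>The quantum spatial ageing algebra as a quotient\<close>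

text \<open>All elements of the quotient algebra are handled through representatives in the free algebra, where
  products and sums are ordinary type class operations.\<close>
abbreviation cls :: "'k::field \<Rightarrow> (gen, 'k) free_alg \<Rightarrow> (gen, 'k) free_alg set" where
  "cls q a \<equiv> qsa_ideal q +>\<^bsub>free_algebra\<^esub> a"

lemma ideal_qsa_ideal: "ideal (qsa_ideal q) free_algebra"
  unfolding qsa_ideal_def
  by (rule ring.genideal_ideal[OF ring_free_algebra]) (simp add: free_algebra_def)

lemma cls_hom: "ring_hom_ring free_algebra (qsa q) (cls q)"
  unfolding qsa_def by (rule ideal.rcos_ring_hom_ring[OF ideal_qsa_ideal])

lemma free_algebra_simps [simp]:
  "carrier free_algebra = UNIV" "a \<otimes>\<^bsub>free_algebra\<^esub> b = a * b" "\<one>\<^bsub>free_algebra\<^esub> = 1"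
  "\<zero>\<^bsub>free_algebra\<^esub> = 0" "a \<oplus>\<^bsub>free_algebra\<^esub> b = a + b"
  by (simp_all add: free_algebra_def)

lemma free_algebra_a_inv [simp]: "\<ominus>\<^bsub>free_algebra\<^esub> a = - a"
proof -
  interpret ring free_algebra by (rule ring_free_algebra)
  show ?thesis by (rule minus_equality) simp_all
qed

lemma cls_simps:
  "cls q a \<in> carrier (qsa q)"
  "cls q a \<otimes>\<^bsub>qsa q\<^esub> cls q b = cls q (a * b)"
  "cls q a \<oplus>\<^bsub>qsa q\<^esub> cls q b = cls q (a + b)"
  "\<one>\<^bsub>qsa q\<^esub> = cls q 1" "\<zero>\<^bsub>qsa q\<^esub> = cls q 0" "\<ominus>\<^bsub>qsa q\<^esub> cls q a = cls q (- a)"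
  "cls q a [^]\<^bsub>qsa q\<^esub> (n::nat) = cls q (a ^ n)"
proof -
  interpret h: ring_hom_ring free_algebra "qsa q" "cls q" by (rule cls_hom)
  show "cls q a \<in> carrier (qsa q)" "cls q a \<otimes>\<^bsub>qsa q\<^esub> cls q b = cls q (a * b)"
    "cls q a \<oplus>\<^bsub>qsa q\<^esub> cls q b = cls q (a + b)"
    "\<one>\<^bsub>qsa q\<^esub> = cls q 1" "\<zero>\<^bsub>qsa q\<^esub> = cls q 0" "\<ominus>\<^bsub>qsa q\<^esub> cls q a = cls q (- a)"
    using ring_hom_closed[OF h.homh] ring_hom_mult[OF h.homh]
      ring_hom_add[OF h.homh] ring_hom_one[OF h.homh] h.hom_zero h.hom_a_inv
    by simp_all
  have "cls q a \<otimes>\<^bsub>qsa q\<^esub> cls q b = cls q (a * b)" for a b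
    using ring_hom_mult[OF h.homh] by simp
  then show "cls q a [^]\<^bsub>qsa q\<^esub> (n::nat) = cls q (a ^ n)"
    by (induction n) (use ring_hom_one[OF h.homh] in \<open>simp_all add: power_commutes[symmetric]\<close>)
qed

lemma carrier_qsa: "carrier (qsa q) = range (cls q)"
  by (auto simp: qsa_def FactRing_def A_RCOSETS_def')

lemma cls_eqI: "a - b \<in> qsa_ideal q \<Longrightarrow> cls q a = cls q b"
proof -
  assume *: "a - b \<in> qsa_ideal q"
  interpret ideal "qsa_ideal q" free_algebra by (rule ideal_qsa_ideal)
  have "a = (a - b) \<oplus>\<^bsub>free_algebra\<^esub> b" by simp
  then have "a \<in> cls q b" using * unfolding a_r_coset_def' by blast
  then show ?thesis using a_repr_independence[OF _ _ a_subgroup] by simp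
qed

lemma cls_eqD: "cls q a = cls q b \<Longrightarrow> a - b \<in> qsa_ideal q"
proof -
  interpret I: ideal "qsa_ideal q" free_algebra by (rule ideal_qsa_ideal)
  assume "cls q a = cls q b"
  moreover have "a \<in> cls q a" by (rule I.a_rcos_self) simp
  ultimately obtain h where "h \<in> qsa_ideal q" "a = h + b" by (auto simp: a_r_coset_def')
  then show ?thesis by simp
qed

lemma qsa_rels_cls:
  fixes q :: "'k::field"
  defines "E \<equiv> letter GE" and "K \<equiv> letter GK" and "K' \<equiv> letter GKinv" and "X \<equiv> letter GX"
    and "Y \<equiv> letter GY"
  shows "cls q (K * K') = cls q 1" "cls q (K' * K) = cls q 1"
    "cls q (E * K) = cls q (const (q powi (-2)) * K * E)"
    "cls q (X * K) = cls q (const (q powi (-1)) * K * X)"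
    "cls q (Y * K) = cls q (const q * K * Y)"
    "cls q (E * X) = cls q (const q * X * E)"
    "cls q (E * Y) = cls q (X + const (q powi (-1)) * Y * E)"
    "cls q (X * Y) = cls q (const q * Y * X)"
proof -
  have "r \<in> qsa_ideal q" if "r \<in> qsa_rels q" for r
    using ring.genideal_self[OF ring_free_algebra, of "qsa_rels q"] that by (auto simp: qsa_ideal_def)
  then show "cls q (K * K') = cls q 1" "cls q (K' * K) = cls q 1"
    "cls q (E * K) = cls q (const (q powi (-2)) * K * E)"
    "cls q (X * K) = cls q (const (q powi (-1)) * K * X)"
    "cls q (Y * K) = cls q (const q * K * Y)"
    "cls q (E * X) = cls q (const q * X * E)"
    "cls q (E * Y) = cls q (X + const (q powi (-1)) * Y * E)"
    "cls q (X * Y) = cls q (const q * Y * X)"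
    by (intro cls_eqI; simp add: qsa_rels_def Let_def E_def K_def K'_def X_def Y_def)+
qed

lemma const_central: "const c * a = a * const c"
proof (induction a rule: free_alg_induct)
  case (single w d)
  show ?case by (simp add: const_def mult_single mult.commute)
qed (simp_all add: distrib_left distrib_right)

section \<open>Commutation up to scalars\<close>

lemma const_mult: "const c * const d = const (c * d)"
  by (simp add: const_def mult_single)

lemma const_zero: "const 0 = 0" and const_one: "const 1 = 1"
  by (simp_all add: const_def)

lemma cls_mult_cong:
  "cls q a = cls q a' \<Longrightarrow> cls q b = cls q b' \<Longrightarrow> cls q (a * b) = cls q (a' * b')"
  by (metis cls_simps(2))

text \<open>Commutation in the quotient algebra up to a scalar. The value of the scalar is left open: for the spanning argument
  only the line in which a vector lies matters, and the exact coefficients are read off the model later.\<close>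
definition qcomm :: "'k::field \<Rightarrow> (gen, 'k) free_alg \<Rightarrow> (gen, 'k) free_alg \<Rightarrow> bool" where
  "qcomm q a b \<longleftrightarrow> (\<exists>c. cls q (a * b) = cls q (const c * b * a))"

lemma qcommI: "cls q (a * b) = cls q (const c * b * a) \<Longrightarrow> qcomm q a b"
  by (auto simp: qcomm_def)

lemma qcomm_flip:
  assumes "cls q (b * a) = cls q (const c * a * b)" and "c \<noteq> 0"
  shows "qcomm q a b"
proof (rule qcommI)
  have "cls q (const (inverse c) * (b * a)) = cls q (const (inverse c) * (const c * a * b))"
    by (rule cls_mult_cong) (simp_all add: assms)
  also have "const (inverse c) * (const c * a * b) = a * b"
    using assms(2) by (simp add: const_mult const_one mult.assoc[symmetric])
  finally show "cls q (a * b) = cls q (const (inverse c) * b * a)" by (simp add: mult.assoc)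
qed

lemma qcomm_power_left:
  assumes "qcomm q a b" shows "qcomm q (a ^ n) b"
proof (induction n)
  case 0
  show ?case by (rule qcommI[of _ _ _ 1]) (simp add: const_one)
next
  case (Suc n)
  obtain c d where c: "cls q (a * b) = cls q (const c * b * a)"
    and d: "cls q (a ^ n * b) = cls q (const d * b * a ^ n)"
    using assms Suc by (auto simp: qcomm_def)
  have "cls q (a ^ Suc n * b) = cls q (a * (a ^ n * b))" by (simp add: mult.assoc)
  also have "\<dots> = cls q (a * (const d * b * a ^ n))" by (rule cls_mult_cong) (simp_all add: d)
  also have "a * (const d * b * a ^ n) = (a * const d) * (b * a ^ n)" by (simp only: mult.assoc)
  also have "\<dots> = const d * ((a * b) * a ^ n)"
    by (simp only: const_central[of d a, symmetric] mult.assoc)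
  also have "cls q \<dots> = cls q (const d * ((const c * b * a) * a ^ n))"
    by (intro cls_mult_cong c refl)
  also have "const d * ((const c * b * a) * a ^ n) = const (d * c) * b * a ^ Suc n"
    by (simp add: const_mult[symmetric] mult.assoc)
  finally show ?case by (rule qcommI)
qed

lemma qcomm_power_right:
  assumes "qcomm q a b" shows "qcomm q a (b ^ n)"
proof (induction n)
  case 0
  show ?case by (rule qcommI[of _ _ _ 1]) (simp add: const_one)
next
  case (Suc n)
  obtain c d where c: "cls q (a * b) = cls q (const c * b * a)"
    and d: "cls q (a * b ^ n) = cls q (const d * b ^ n * a)"
    using assms Suc by (auto simp: qcomm_def)
  have "cls q (a * b ^ Suc n) = cls q ((a * b) * b ^ n)" by (simp add: mult.assoc)
  also have "\<dots> = cls q ((const c * b * a) * b ^ n)" by (intro cls_mult_cong c refl)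
  also have "(const c * b * a) * b ^ n = (const c * b) * (a * b ^ n)" by (simp add: mult.assoc)
  also have "cls q \<dots> = cls q ((const c * b) * (const d * b ^ n * a))" by (intro cls_mult_cong d refl)
  also have "(const c * b) * (const d * b ^ n * a) = const c * (b * const d) * b ^ n * a"
    by (simp only: mult.assoc)
  also have "\<dots> = const (c * d) * b ^ Suc n * a"
    by (simp only: const_central[of d b, symmetric] const_mult[symmetric] power_Suc mult.assoc)
  finally show ?case by (rule qcommI)
qed

section \<open>The coefficient model of the Verma module\<close>

definition coeff_scale :: "'k::field \<Rightarrow> (nat \<Rightarrow> int \<Rightarrow> 'k) \<Rightarrow> nat \<Rightarrow> int \<Rightarrow> 'k" where
  "coeff_scale c x = (\<lambda>m n. c * x m n)"

text \<open>This is \<open>q\<close> times the quantum integer \<open>(q\<^sup>m - q\<^sup>-\<^sup>m) / (q - q\<^sup>-\<^sup>1)\<close>. The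
  element \<open>Y\<^sup>m E\<close> equals \<open>q\<^sup>m E Y\<^sup>m - low_coeff q m X Y\<^sup>m\<^sup>-\<^sup>1\<close> in the algebra.\<close>
definition low_coeff :: "'k::field \<Rightarrow> nat \<Rightarrow> 'k" where
  "low_coeff q m = q * (q ^ m - inverse q ^ m) / (q - inverse q)"

text \<open>\<open>x m n\<close> plays the role of the coefficient of \<open>f(m, n)\<close>, so an operator that sends \<open>f(m, n)\<close> to a multiple of
  \<open>f(m', n')\<close> moves the value at \<open>(m, n)\<close> to \<open>(m', n')\<close>. Two choices keep this free of side conditions: all functions are
  admitted, not only those of finite support, and \<open>n\<close> runs through all integers, so that \<open>K\<close> is an invertible shift. The relation
  \<open>f(m, n + l) = lam2 f(m, n)\<close> is not built in; it will hold on the functions that matter, in the form of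
  a twisted periodicity in \<open>n\<close>.\<close>
fun coeff_step :: "'k::field \<Rightarrow> 'k \<Rightarrow> gen \<Rightarrow> (nat \<Rightarrow> int \<Rightarrow> 'k) \<Rightarrow> nat \<Rightarrow> int \<Rightarrow> 'k" where
  "coeff_step q lam1 GE x = (\<lambda>m n. - lam1 * q powi (2 * n) * low_coeff q (Suc m) * x (Suc m) n)"
| "coeff_step q lam1 GK x = (\<lambda>m n. x m (n - 1))"
| "coeff_step q lam1 GKinv x = (\<lambda>m n. x m (n + 1))"
| "coeff_step q lam1 GX x = (\<lambda>m n. lam1 * q powi (n - int m) * x m n)"
| "coeff_step q lam1 GY x = (\<lambda>m n. if m = 0 then 0 else q powi (- n) * x (m - 1) n)"

lemma low_coeff_Suc:
  assumes "q \<noteq> 0" and "q ^ 2 \<noteq> 1"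
  shows "low_coeff q (Suc m) = q * low_coeff q m + q * inverse q ^ m"
proof -
  have "q - inverse q \<noteq> 0" using assms by (auto simp: power2_eq_square field_simps)
  then show ?thesis using assms by (simp add: low_coeff_def field_simps)
qed

lemma low_coeff_eq_0_iff:
  assumes "q \<noteq> 0" and "q ^ 2 \<noteq> 1"
  shows "low_coeff q m = 0 \<longleftrightarrow> q ^ (2 * m) = 1"
proof -
  have "q - inverse q \<noteq> 0" using assms by (auto simp: power2_eq_square field_simps)
  then have "low_coeff q m = 0 \<longleftrightarrow> q ^ m = inverse q ^ m" using assms by (simp add: low_coeff_def)
  also have "\<dots> \<longleftrightarrow> q ^ m * q ^ m = 1" using assms by (simp add: power_inverse field_simps)
  finally show ?thesis by (simp add: mult_2 power_add)
qed

locale verma_params =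
  fixes q lam1 lam2 :: "'k::field" and l :: nat
  assumes l: "l \<ge> 3" "odd l" and ql: "q ^ l = 1" and qk: "\<And>k. 0 < k \<Longrightarrow> k < l \<Longrightarrow> q ^ k \<noteq> 1"
    and lam: "lam1 \<noteq> 0" "lam2 \<noteq> 0"
begin

lemma q0: "q \<noteq> 0" using ql l by (auto simp: power_0_left)

lemma q2: "q ^ 2 \<noteq> 1" using qk[of 2] l by simp

sublocale V: letter_action coeff_scale "coeff_step q lam1"
proof unfold_locales
  fix g x y c
  show "coeff_step q lam1 g (x + y) = coeff_step q lam1 g x + coeff_step q lam1 g y"
    by (cases g) (auto simp: fun_eq_iff algebra_simps)
  show "coeff_step q lam1 g (coeff_scale c x) = coeff_scale c (coeff_step q lam1 g x)"
    by (cases g) (auto simp: fun_eq_iff coeff_scale_def)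
qed (auto simp: coeff_scale_def fun_eq_iff algebra_simps)

text \<open>The only relation that is not immediate is the one for \<open>E Y\<close>. It compares the scalars of \<open>E\<close> in two successive
  degrees and amounts to the recursion \<open>low_coeff_Suc\<close>.\<close>
lemma act_rels: "a \<in> qsa_rels q \<Longrightarrow> V.act x a = 0"
proof -
  have low: "low_coeff q (Suc 0) = q" using low_coeff_Suc[OF q0 q2, of 0] by (simp add: low_coeff_def)
  have dbl: "q powi (n * 2) = q powi n * q powi n" for n
    using q0 power_int_add[of q n n] by (simp add: mult_2_right)
  have pred: "q * q ^ (m - Suc 0) = q ^ m" if "0 < m" for m
    using that by (cases m) simp_all
  note s = V.act_mult V.act_diff V.act_add coeff_scale_def fun_eq_iff
  assume "a \<in> qsa_rels q"
  then show ?thesis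
    unfolding qsa_rels_def Let_def
  proof (elim insertE emptyE)
    assume a: "a = letter GE * letter GY - (letter GX + const (q powi (-1)) * letter GY * letter GE)"
    have "V.act x a m n = 0" for m n
    proof (cases m)
      case 0
      then show ?thesis using q0
        by (simp add: a s power_int_diff power_int_minus low field_simps dbl low_coeff_def[of q 0])
    next
      case (Suc k)
      have "q ^ k * low_coeff q (Suc (Suc k)) = 1 + q * (q ^ k * low_coeff q (Suc k))"
        using q0 low_coeff_Suc[OF q0 q2, of "Suc k"] by (simp add: field_simps)
      then have "q ^ k * (z * low_coeff q (Suc (Suc k))) = z + q * (q ^ k * (z * low_coeff q (Suc k)))" for z
        by (metis (no_types, opaque_lifting) distrib_left mult.left_commute mult.right_neutral)
      from this[of "lam1 * (q powi n * x (Suc k) n)"] show ?thesis using q0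
        by (simp add: Suc a s power_int_diff power_int_minus field_simps dbl)
    qed
    then show ?thesis by (simp add: fun_eq_iff)
  qed ((hypsubst, use q0 in \<open>auto simp: s power_int_diff power_int_add power_int_minus power2_eq_square field_simps
      dbl of_nat_diff pred\<close>)[1])+
qed

section \<open>The character of the subalgebra\<close>

text \<open>By \<open>act_rels\<close> the action of the free algebra on functions depends on the class only.\<close>
definition qact :: "(nat \<Rightarrow> int \<Rightarrow> 'k) \<Rightarrow> (gen, 'k) free_alg set \<Rightarrow> nat \<Rightarrow> int \<Rightarrow> 'k" where
  "qact x C = V.act x (SOME a. C = cls q a)"

lemma qact_cls [simp]: "qact x (cls q a) = V.act x a"
proof -
  have "cls q a = cls q (SOME b. cls q a = cls q b)" by (rule someI[of _ a]) simp
  then have "a - (SOME b. cls q a = cls q b) \<in> genideal free_algebra (qsa_rels q)"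
    using cls_eqD by (auto simp: qsa_ideal_def)
  from V.act_genideal[OF act_rels this, of x] show ?thesis
    by (simp add: qact_def V.act_diff)
qed

lemma qact_simps:
  "C \<in> carrier (qsa q) \<Longrightarrow> D \<in> carrier (qsa q) \<Longrightarrow> qact x (C \<oplus>\<^bsub>qsa q\<^esub> D) = qact x C + qact x D"
  "C \<in> carrier (qsa q) \<Longrightarrow> D \<in> carrier (qsa q) \<Longrightarrow> qact x (C \<otimes>\<^bsub>qsa q\<^esub> D) = qact (qact x C) D"
  "C \<in> carrier (qsa q) \<Longrightarrow> qact x (\<ominus>\<^bsub>qsa q\<^esub> C) = - qact x C"
  "C \<in> carrier (qsa q) \<Longrightarrow> qact (x + y) C = qact x C + qact y C"
  "C \<in> carrier (qsa q) \<Longrightarrow> qact (coeff_scale c x) C = coeff_scale c (qact x C)"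
  "C \<in> carrier (qsa q) \<Longrightarrow> qact 0 C = 0"
  by (auto simp: carrier_qsa cls_simps V.act_add V.act_mult V.act_minus V.act_add_left V.act_scale_left)

lemma qact_one: "qact x \<one>\<^bsub>qsa q\<^esub> = x"
  by (simp add: cls_simps)

text \<open>The image of \<open>v = f(0, 0)\<close>. Because indices \<open>n\<close> that are congruent modulo \<open>l\<close> describe the same basis vector up to powers
  of \<open>lam2\<close>, the basis vector is represented by the formal sum over all integers \<open>j\<close> of \<open>lam2\<^sup>-\<^sup>j f(0, j l)\<close>. The shift by \<open>l\<close>
  multiplies this sum by \<open>lam2\<close>, as \<open>v K\<^sup>l = lam2 v\<close> demands.\<close>
definition cyc :: "nat \<Rightarrow> int \<Rightarrow> 'k" where
  "cyc m n = (if m = 0 \<and> int l dvd n then lam2 powi (- (n div int l)) else 0)"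

lemma cyc_shift: "cyc m (n - int l) = lam2 * cyc m n" "cyc m (n + int l) = inverse lam2 * cyc m n"
proof -
  have l0: "int l \<noteq> 0" using l by simp
  have d: "(n - int l) div int l = n div int l - 1" "(n + int l) div int l = n div int l + 1"
    using l0 div_add_self2[of "int l" "n - int l"] by simp_all
  have "int l dvd n - int l \<longleftrightarrow> int l dvd n" "int l dvd n + int l \<longleftrightarrow> int l dvd n"
    by (simp_all add: dvd_diff_left_iff dvd_add_left_iff)
  then show "cyc m (n - int l) = lam2 * cyc m n" "cyc m (n + int l) = inverse lam2 * cyc m n"
    using lam by (simp_all add: cyc_def d power_int_diff power_int_add power_int_minus field_simps)
qed

lemma act_K_power: "V.act x (letter GK ^ n) = (\<lambda>m k. x m (k - int n))"
  by (induction n) (auto simp: V.act_mult power_commutes[symmetric] fun_eq_iff algebra_simps simp del: power_commutes)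

lemma act_Kinv_power: "V.act x (letter GKinv ^ n) = (\<lambda>m k. x m (k + int n))"
  by (induction n) (auto simp: V.act_mult power_commutes[symmetric] fun_eq_iff algebra_simps simp del: power_commutes)

lemma act_Y_power:
  "V.act x (letter GY ^ n) = (\<lambda>m k. if m < n then 0 else q powi (- (k * int n)) * x (m - n) k)"
proof (induction n)
  case (Suc n)
  have "V.act x (letter GY ^ Suc n) = coeff_step q lam1 GY (V.act x (letter GY ^ n))"
    by (simp only: power_Suc2 V.act_mult V.act_letter)
  also have "\<dots> = (\<lambda>m k. if m < Suc n then 0 else q powi (- (k * int (Suc n))) * x (m - Suc n) k)"
    using q0 by (auto simp: Suc.IH fun_eq_iff distrib_left power_int_diff power_int_minus power_int_add field_simps
        simp del: of_nat_Suc)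
      (auto simp: algebra_simps power_int_add)
  finally show ?case .
qed simp

lemma cyc_low: "m \<noteq> 0 \<Longrightarrow> cyc m n = 0"
  by (simp add: cyc_def)

lemma q_powi_dvd: "int l dvd n \<Longrightarrow> q powi n = 1"
proof (elim dvdE)
  fix k assume "n = int l * k"
  then have "q powi n = (q ^ l) powi k" using q0 by (simp add: power_int_mult)
  then show "q powi n = 1" by (simp add: ql)
qed

lemma cyc_gens:
  "qact cyc (qsa_const q c) = coeff_scale c cyc"
  "qact cyc (qsa_gen q GE) = coeff_scale 0 cyc"
  "qact cyc (qsa_gen q GX) = coeff_scale lam1 cyc"
  "qact cyc (qsa_gen q GK [^]\<^bsub>qsa q\<^esub> l) = coeff_scale lam2 cyc"
  "qact cyc (qsa_gen q GKinv [^]\<^bsub>qsa q\<^esub> l) = coeff_scale (inverse lam2) cyc"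
proof -
  show "qact cyc (qsa_const q c) = coeff_scale c cyc" by (simp add: qsa_const_def)
  show "qact cyc (qsa_gen q GE) = coeff_scale 0 cyc"
    by (simp add: qsa_gen_def coeff_scale_def fun_eq_iff cyc_low)
  show "qact cyc (qsa_gen q GX) = coeff_scale lam1 cyc"
    by (auto simp: qsa_gen_def coeff_scale_def fun_eq_iff cyc_def q_powi_dvd)
  show "qact cyc (qsa_gen q GK [^]\<^bsub>qsa q\<^esub> l) = coeff_scale lam2 cyc"
    "qact cyc (qsa_gen q GKinv [^]\<^bsub>qsa q\<^esub> l) = coeff_scale (inverse lam2) cyc"
    by (simp_all add: qsa_gen_def cls_simps act_K_power act_Kinv_power cyc_shift coeff_scale_def fun_eq_iff)
qed

definition Bgens :: "(gen, 'k) free_alg set set" where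
  "Bgens = range (qsa_const q) \<union>
      {qsa_gen q GE, qsa_gen q GX, qsa_gen q GK [^]\<^bsub>qsa q\<^esub> l, qsa_gen q GKinv [^]\<^bsub>qsa q\<^esub> l}"

lemma Bgens_carrier: "Bgens \<subseteq> carrier (qsa q)"
  by (auto simp: Bgens_def qsa_const_def qsa_gen_def cls_simps)

lemma B_simps [simp]:
  "carrier (qsa_B q l) = generate_ring (qsa q) Bgens" "ring.add (qsa_B q l) = ring.add (qsa q)"
  "monoid.mult (qsa_B q l) = monoid.mult (qsa q)" "\<one>\<^bsub>qsa_B q l\<^esub> = \<one>\<^bsub>qsa q\<^esub>"
  by (simp_all add: qsa_B_def Bgens_def)

lemma B_carrier: "b \<in> generate_ring (qsa q) Bgens \<Longrightarrow> b \<in> carrier (qsa q)"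
  by (rule ring.generate_ring_in_carrier[OF ring_qsa Bgens_carrier])

lemma ring_B: "ring (qsa_B q l)"
  unfolding qsa_B_def using ring.generate_ring_is_ring[OF ring_qsa Bgens_carrier]
  by (simp add: Bgens_def)

lemma coeff_scale_simps:
  "coeff_scale a (coeff_scale b x) = coeff_scale (a * b) x"
  "coeff_scale a x + coeff_scale b x = coeff_scale (a + b) x"
  "- coeff_scale a x = coeff_scale (- a) x"
  by (simp_all add: coeff_scale_def fun_eq_iff algebra_simps)

text \<open>Being an eigenvector is inherited by sums and products of ring elements, so it is enough to look at the
  generators of \<open>\<B>\<close>.\<close>
lemma cyc_eigen: "b \<in> generate_ring (qsa q) Bgens \<Longrightarrow> \<exists>c. qact cyc b = coeff_scale c cyc"
proof (induction rule: generate_ring.induct)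
  case one
  show ?case by (rule exI[of _ 1]) (simp add: qact_one)
next
  case (incl h)
  then show ?case using cyc_gens unfolding Bgens_def by blast
next
  case (a_inv h)
  then obtain c where c: "qact cyc h = coeff_scale c cyc" by blast
  have "qact cyc (\<ominus>\<^bsub>qsa q\<^esub> h) = coeff_scale (- c) cyc"
    using B_carrier[OF a_inv.hyps] by (simp only: qact_simps(3) c coeff_scale_simps(3))
  then show ?case by blast
next
  case (eng_add h1 h2)
  then obtain c d where c: "qact cyc h1 = coeff_scale c cyc" "qact cyc h2 = coeff_scale d cyc" by blast
  have "qact cyc (h1 \<oplus>\<^bsub>qsa q\<^esub> h2) = coeff_scale (c + d) cyc"
    using eng_add.hyps[THEN B_carrier] by (simp only: qact_simps(1) c coeff_scale_simps(2))
  then show ?case by blast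
next
  case (eng_mult h1 h2)
  then show ?case using eng_mult.hyps[THEN B_carrier] by (auto simp: qact_simps coeff_scale_simps)
qed

definition eigval :: "(gen, 'k) free_alg set \<Rightarrow> 'k" where "eigval b = qact cyc b 0 0"

lemma cyc_00: "cyc 0 0 = 1" by (simp add: cyc_def)

lemma eigvalI: "qact cyc b = coeff_scale c cyc \<Longrightarrow> eigval b = c"
  by (simp add: eigval_def coeff_scale_def cyc_00)

lemma cyc_eigval: "b \<in> generate_ring (qsa q) Bgens \<Longrightarrow> qact cyc b = coeff_scale (eigval b) cyc"
  using cyc_eigen eigvalI by metis

text \<open>The eigenvalue of \<open>cyc\<close> is the required character of \<open>\<B>\<close>.\<close>
lemma char_exists: "is_char_action q l lam1 lam2 (\<lambda>x b. x * eigval b)"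
  unfolding is_char_action_def
proof (intro conjI allI)
  let ?N = "char_module_of_action (\<lambda>x b. x * eigval b)"
  interpret B: ring "qsa_B q l" by (rule ring_B)
  have "abelian_group ?N"
    by (rule abelian_groupI)
      (auto simp: char_module_of_action_def ac_simps intro: exI[of _ "- _"] left_minus)
  then show "right_module (qsa_B q l) ?N"
  proof (intro right_module.intro right_module_axioms.intro B.ring_axioms)
    fix x a b
    assume ab: "a \<in> carrier (qsa_B q l)" "b \<in> carrier (qsa_B q l)"
    then have e: "eigval (a \<oplus>\<^bsub>qsa q\<^esub> b) = eigval a + eigval b"
      "eigval (a \<otimes>\<^bsub>qsa q\<^esub> b) = eigval a * eigval b"
      using ab[simplified, THEN cyc_eigval] ab[simplified, THEN B_carrier]
      by (auto intro!: eigvalI simp: qact_simps coeff_scale_simps mult.commute)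
    show "x \<odot>\<^sub>r\<^bsub>?N\<^esub> (a \<oplus>\<^bsub>qsa_B q l\<^esub> b) = x \<odot>\<^sub>r\<^bsub>?N\<^esub> a \<oplus>\<^bsub>?N\<^esub> x \<odot>\<^sub>r\<^bsub>?N\<^esub> b"
      "x \<odot>\<^sub>r\<^bsub>?N\<^esub> (a \<otimes>\<^bsub>qsa_B q l\<^esub> b) = (x \<odot>\<^sub>r\<^bsub>?N\<^esub> a) \<odot>\<^sub>r\<^bsub>?N\<^esub> b"
      by (simp_all add: char_module_of_action_def e algebra_simps)
  next
    have "eigval \<one>\<^bsub>qsa q\<^esub> = 1" by (rule eigvalI) (simp add: qact_one)
    then show "x \<odot>\<^sub>r\<^bsub>?N\<^esub> \<one>\<^bsub>qsa_B q l\<^esub> = x" for x by (simp add: char_module_of_action_def)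
  qed (simp_all add: char_module_of_action_def algebra_simps)
qed (use cyc_gens[THEN eigvalI] in simp_all)

definition char_act :: "'k \<Rightarrow> (gen, 'k) free_alg set \<Rightarrow> 'k" where
  "char_act = (SOME \<alpha>. is_char_action q l lam1 lam2 \<alpha>)"

lemma is_char: "is_char_action q l lam1 lam2 char_act"
  unfolding char_act_def by (rule someI[of "is_char_action q l lam1 lam2"]) (rule char_exists)

lemma char_module_eq: "char_module q l lam1 lam2 = char_module_of_action char_act"
  by (simp add: char_module_def char_act_def)

lemma char_simps [simp]:
  "carrier (char_module q l lam1 lam2) = UNIV"
  "ring.add (char_module q l lam1 lam2) = (+)"
  "ract (char_module q l lam1 lam2) = char_act"
  by (simp_all add: char_module_eq char_module_of_action_def)

sublocale Ind: induced "qsa_B q l" "qsa q" "char_module q l lam1 lam2"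
proof (intro induced.intro induced_axioms.intro ring_qsa)
  show "right_module (qsa_B q l) (char_module q l lam1 lam2)"
    using is_char by (simp add: is_char_action_def char_module_eq)
  show "carrier (qsa_B q l) \<subseteq> carrier (qsa q)" using B_carrier by auto
qed

lemma char_act_const: "char_act x (qsa_const q c) = x * c"
  using is_char by (simp add: is_char_action_def)

lemma const_B: "qsa_const q c \<in> generate_ring (qsa q) Bgens"
  by (rule generate_ring.incl) (simp add: Bgens_def)

text \<open>The action that was chosen in the definition of the one-dimensional module is pinned down by its values
  on the generators, hence it is the one given by eigenvalues of \<open>cyc\<close>.\<close>
lemma char_act_eq:
  assumes b: "b \<in> generate_ring (qsa q) Bgens"
  shows "char_act x b = x * eigval b"
proof -
  \<comment> \<open>The scalars of the ring are central, so the action of \<open>b\<close> commutes with them.\<close>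
  have lin: "char_act x b = x * char_act 1 b" if b: "b \<in> generate_ring (qsa q) Bgens" for x b
  proof -
    obtain a where a: "b = cls q a" using B_carrier[OF b] by (auto simp: carrier_qsa)
    have "char_act x b = char_act (char_act 1 (qsa_const q x)) b" by (simp add: char_act_const)
    also have "\<dots> = char_act 1 (qsa_const q x \<otimes>\<^bsub>qsa q\<^esub> b)"
      using Ind.N.ract_mult[of 1 "qsa_const q x" b] b const_B by simp
    also have "qsa_const q x \<otimes>\<^bsub>qsa q\<^esub> b = b \<otimes>\<^bsub>qsa q\<^esub> qsa_const q x"
      by (simp add: a qsa_const_def cls_simps const_central)
    also have "char_act 1 (b \<otimes>\<^bsub>qsa q\<^esub> qsa_const q x) = char_act (char_act 1 b) (qsa_const q x)"
      using Ind.N.ract_mult[of 1 b "qsa_const q x"] b const_B by simp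
    finally show ?thesis by (simp add: char_act_const mult.commute)
  qed
  have "qact cyc b = coeff_scale (char_act 1 b) cyc"
    using b
  proof (induction rule: generate_ring.induct)
    case one
    then show ?case using Ind.N.ract_one[of 1] by (simp add: qact_one)
  next
    case (incl h)
    have "qsa_const q c \<in> range (qsa_const q)" for c by simp
    have "char_act 1 (qsa_const q c) = c" for c using char_act_const[of 1 c] by simp
    with incl show ?case using cyc_gens is_char unfolding is_char_action_def Bgens_def
      by (elim UnE rangeE insertE emptyE) (simp_all only:)
  next
    case (a_inv h)
    have "char_act 1 (\<ominus>\<^bsub>qsa q\<^esub> h \<oplus>\<^bsub>qsa q\<^esub> h) = char_act 1 (\<ominus>\<^bsub>qsa q\<^esub> h) + char_act 1 h"
      using Ind.N.ract_add_right[of 1 "\<ominus>\<^bsub>qsa q\<^esub> h" h] a_inv.hyps generate_ring.a_inv[OF a_inv.hyps] by simp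
    moreover have "\<ominus>\<^bsub>qsa q\<^esub> h \<oplus>\<^bsub>qsa q\<^esub> h = qsa_const q 0"
      using B_carrier[OF a_inv.hyps] by (simp add: Ind.S.l_neg qsa_const_def cls_simps const_def)
    ultimately have "char_act 1 (\<ominus>\<^bsub>qsa q\<^esub> h) = - char_act 1 h"
      by (simp add: char_act_const eq_neg_iff_add_eq_0)
    then show ?case using B_carrier[OF a_inv.hyps]
      by (simp only: qact_simps(3) a_inv.IH coeff_scale_simps(3))
  next
    case (eng_add h1 h2)
    have "char_act 1 (h1 \<oplus>\<^bsub>qsa q\<^esub> h2) = char_act 1 h1 + char_act 1 h2"
      using Ind.N.ract_add_right[of 1 h1 h2] eng_add.hyps by simp
    then show ?case using eng_add.hyps[THEN B_carrier]
      by (simp only: qact_simps(1) eng_add.IH coeff_scale_simps(2))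
  next
    case (eng_mult h1 h2)
    then show ?case
      using eng_mult.hyps eng_mult.hyps[THEN B_carrier] Ind.N.ract_mult[of 1 h1 h2]
        lin[OF eng_mult.hyps(2), of "char_act 1 h1"]
      by (simp add: qact_simps(2,5) eng_mult.IH coeff_scale_simps mult.commute)
  qed
  then have "eigval b = char_act 1 b" by (rule eigvalI)
  then show ?thesis using lin[OF b, of x] by (simp only:)
qed

section \<open>Coordinates on the Verma module\<close>

abbreviation "M \<equiv> verma q l lam1 lam2"
abbreviation "f \<equiv> verma_f q l lam1 lam2"
abbreviation "pure \<equiv> pure_tensor (qsa_B q l) (qsa q) (char_module q l lam1 lam2)"

lemma verma_eq: "M = induced_module (qsa_B q l) (qsa q) (char_module q l lam1 lam2)"
  by (simp add: verma_def)

sublocale M: right_module "qsa q" M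
  unfolding verma_eq by (rule Ind.right_module_I)

text \<open>The homomorphism \<open>v \<otimes> a \<mapsto> cyc a\<close>; the balancing condition of the tensor product
  holds because \<open>cyc\<close> and \<open>v\<close> have the same eigenvalues under \<open>\<B>\<close>.\<close>
definition coords :: "'k verma_elt \<Rightarrow> nat \<Rightarrow> int \<Rightarrow> 'k" where
  "coords = (SOME \<phi>. (\<forall>C\<in>carrier M. \<forall>D\<in>carrier M. \<phi> (C \<oplus>\<^bsub>M\<^esub> D) = \<phi> C + \<phi> D) \<and>
     (\<forall>x. \<forall>s\<in>carrier (qsa q). \<phi> (pure x s) = coeff_scale x (qact cyc s)))"

lemma coords_spec:
  "C \<in> carrier M \<Longrightarrow> D \<in> carrier M \<Longrightarrow> coords (C \<oplus>\<^bsub>M\<^esub> D) = coords C + coords D"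
  "s \<in> carrier (qsa q) \<Longrightarrow> coords (pure x s) = coeff_scale x (qact cyc s)"
proof -
  have "\<exists>\<phi>. (\<forall>C\<in>carrier M. \<forall>D\<in>carrier M. \<phi> (C \<oplus>\<^bsub>M\<^esub> D) = \<phi> C + \<phi> D) \<and>
     (\<forall>x. \<forall>s\<in>carrier (qsa q). \<phi> (pure x s) = coeff_scale x (qact cyc s))"
    unfolding verma_eq
  proof (rule Ind.induced_universal[of "\<lambda>x s. coeff_scale x (qact cyc s)"])
    fix x r s assume "r \<in> carrier (qsa_B q l)" "s \<in> carrier (qsa q)"
    then show "coeff_scale (x \<odot>\<^sub>r\<^bsub>char_module q l lam1 lam2\<^esub> r) (qact cyc s)
      = coeff_scale x (qact cyc (r \<otimes>\<^bsub>qsa q\<^esub> s))"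
      using B_carrier cyc_eigval by (simp add: char_act_eq qact_simps coeff_scale_simps)
  qed (simp_all add: qact_simps coeff_scale_simps V.scale_right_distrib, blast)
  from someI_ex[OF this, folded coords_def]
  show "C \<in> carrier M \<Longrightarrow> D \<in> carrier M \<Longrightarrow> coords (C \<oplus>\<^bsub>M\<^esub> D) = coords C + coords D"
    "s \<in> carrier (qsa q) \<Longrightarrow> coords (pure x s) = coeff_scale x (qact cyc s)" by blast+
qed

lemma coords_zero: "coords \<zero>\<^bsub>M\<^esub> = 0"
  using coords_spec(1)[of "\<zero>\<^bsub>M\<^esub>" "\<zero>\<^bsub>M\<^esub>"] by simp

lemma coords_minus: "C \<in> carrier M \<Longrightarrow> coords (\<ominus>\<^bsub>M\<^esub> C) = - coords C"
  using coords_spec(1)[of "\<ominus>\<^bsub>M\<^esub> C" C] by (simp add: M.M.l_neg coords_zero eq_neg_iff_add_eq_0)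

lemma coords_diff: "C \<in> carrier M \<Longrightarrow> D \<in> carrier M \<Longrightarrow> coords (C \<ominus>\<^bsub>M\<^esub> D) = coords C - coords D"
  by (simp add: a_minus_def coords_spec coords_minus)

lemma coords_act:
  assumes "C \<in> carrier M" and s: "s \<in> carrier (qsa q)"
  shows "coords (C \<odot>\<^sub>r\<^bsub>M\<^esub> s) = qact (coords C) s"
  using assms(1) unfolding verma_eq
proof (induction C rule: Ind.I_induct)
  case zero
  show ?case unfolding verma_eq[symmetric] M.ract_zero_left[OF s] coords_zero
    by (rule qact_simps(6)[OF s, symmetric])
next
  case (pure x t)
  then show ?case using s Ind.S.m_closed[of t s]
    by (simp add: Ind.pt_act coords_spec qact_simps)
next
  case (diff C D)
  note [folded verma_eq, simp] = diff
  have "(C \<ominus>\<^bsub>M\<^esub> D) \<odot>\<^sub>r\<^bsub>M\<^esub> s = (C \<odot>\<^sub>r\<^bsub>M\<^esub> s) \<ominus>\<^bsub>M\<^esub> (D \<odot>\<^sub>r\<^bsub>M\<^esub> s)"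
    using s by (simp add: a_minus_def M.ract_add_left M.ract_minus_left)
  moreover have "qact (coords C - coords D) s = qact (coords C) s - qact (coords D) s"
    using qact_simps(4)[OF s, of "coords C - coords D" "coords D"] by (simp add: algebra_simps)
  ultimately show ?case
    unfolding verma_eq[symmetric] using s diff[folded verma_eq]
    by (simp only: coords_diff M.ract_closed)
qed

section \<open>Action of the generators on the basis vectors\<close>

abbreviation dot :: "'k verma_elt \<Rightarrow> (gen, 'k) free_alg \<Rightarrow> 'k verma_elt" (infixl \<open>\<bullet>\<close> 70) where
  "C \<bullet> a \<equiv> C \<odot>\<^sub>r\<^bsub>M\<^esub> cls q a"

lemma dot_simps:
  "C \<in> carrier M \<Longrightarrow> C \<bullet> a \<in> carrier M"
  "C \<in> carrier M \<Longrightarrow> C \<bullet> a \<bullet> b = C \<bullet> (a * b)"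
  "C \<in> carrier M \<Longrightarrow> C \<bullet> (a + b) = C \<bullet> a \<oplus>\<^bsub>M\<^esub> C \<bullet> b"
  "C \<in> carrier M \<Longrightarrow> C \<bullet> 1 = C"
  "C \<in> carrier M \<Longrightarrow> C \<bullet> 0 = \<zero>\<^bsub>M\<^esub>"
  "C \<in> carrier M \<Longrightarrow> D \<in> carrier M \<Longrightarrow> (C \<oplus>\<^bsub>M\<^esub> D) \<bullet> a = C \<bullet> a \<oplus>\<^bsub>M\<^esub> D \<bullet> a"
  using M.ract_closed[of C "cls q a"] M.ract_mult[of C "cls q a" "cls q b"]
    M.ract_add_right[of C "cls q a" "cls q b"] M.ract_one[of C] M.ract_zero_right[of C]
    M.ract_add_left[of C D "cls q a"]
  by (simp_all add: cls_simps)

lemma dot_minus: "C \<in> carrier M \<Longrightarrow> C \<bullet> (- a) = \<ominus>\<^bsub>M\<^esub> (C \<bullet> a)"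
  by (rule M.M.minus_equality[symmetric]) (simp_all add: dot_simps flip: dot_simps(3))

lemma coords_dot: "C \<in> carrier M \<Longrightarrow> coords (C \<bullet> a) = V.act (coords C) a"
  by (simp add: coords_act cls_simps)

definition line :: "'k verma_elt \<Rightarrow> 'k verma_elt set" where
  "line x = {x \<bullet> const c | c. True}"

lemma line_self: "x \<in> carrier M \<Longrightarrow> x \<in> line x"
  unfolding line_def using dot_simps(4)[of x] const_one by (metis (mono_tags, lifting) mem_Collect_eq)

lemma line_zero: "x \<in> carrier M \<Longrightarrow> \<zero>\<^bsub>M\<^esub> \<in> line x"
  unfolding line_def using dot_simps(5)[of x] const_zero by (metis (mono_tags, lifting) mem_Collect_eq)

lemma line_const: "x \<bullet> const c \<in> line x"
  by (auto simp: line_def)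

lemma line_dot:
  assumes "x \<in> line y" "y \<in> carrier M"
  shows "x \<bullet> a \<in> line (y \<bullet> a)"
  using assms by (auto simp: line_def dot_simps const_central)

lemma line_trans:
  assumes "x \<in> line y" "y \<in> line z" "z \<in> carrier M"
  shows "x \<in> line z"
  using assms by (auto simp: line_def dot_simps const_mult)

lemma line_add:
  assumes "x \<in> line z" "y \<in> line z" "z \<in> carrier M"
  shows "x \<oplus>\<^bsub>M\<^esub> y \<in> line z"
proof -
  obtain c d where "x = z \<bullet> const c" "y = z \<bullet> const d" using assms by (auto simp: line_def)
  moreover have "const c + const d = const (c + d)" by (simp add: const_def single_add)
  ultimately have "x \<oplus>\<^bsub>M\<^esub> y = z \<bullet> const (c + d)" using dot_simps(3)[OF assms(3)] by metis
  then show ?thesis by (simp add: line_const)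
qed

lemma line_qcomm:
  assumes "qcomm q a b" "x \<in> carrier M"
  shows "x \<bullet> a \<bullet> b \<in> line (x \<bullet> b \<bullet> a)"
proof -
  obtain c where "cls q (a * b) = cls q (const c * b * a)" using assms by (auto simp: qcomm_def)
  then have "x \<bullet> a \<bullet> b = x \<bullet> (const c * (b * a))" using assms by (simp add: dot_simps mult.assoc)
  also have "\<dots> = x \<bullet> b \<bullet> a \<bullet> const c"
    using assms by (simp add: dot_simps const_central)
  finally show ?thesis by (simp add: line_const)
qed

lemma qcomms:
  "qcomm q (letter GK) (letter GY)" "qcomm q (letter GK) (letter GX)"
  "qcomm q (letter GK) (letter GE)" "qcomm q (letter GY) (letter GX)"
  "qcomm q (letter GY) (letter GK)"
  using q0 by (auto intro: qcomm_flip[OF qsa_rels_cls(5)] qcomm_flip[OF qsa_rels_cls(4)]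
      qcomm_flip[OF qsa_rels_cls(3)] qcomm_flip[OF qsa_rels_cls(8)] qcommI[OF qsa_rels_cls(5)])

abbreviation "E \<equiv> letter GE"
abbreviation "K \<equiv> letter GK"
abbreviation "K' \<equiv> letter GKinv"
abbreviation "X \<equiv> letter GX"
abbreviation "Y \<equiv> letter GY"

lemma pure_carrier: "pure x (cls q a) \<in> carrier M"
  unfolding verma_eq by (rule Ind.pt_closed) (simp_all add: cls_simps)

lemma pure_dot: "pure x (cls q a) \<bullet> b = pure x (cls q (a * b))"
  unfolding verma_eq by (subst Ind.pt_act) (simp_all add: cls_simps)

lemma f_eq: "f m n = pure 1 (cls q (Y ^ m * K ^ n))"
  by (simp add: verma_f_def qsa_gen_def cls_simps)

lemma f_carrier [simp]: "f m n \<in> carrier M"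
  by (simp add: f_eq pure_carrier)

lemma f_dot_K: "f m n \<bullet> K ^ k = f m (n + k)"
  by (simp add: f_eq pure_dot power_add mult.assoc)

lemma f_dot_Y: "f m 0 \<bullet> Y ^ k = f (m + k) 0"
  by (simp add: f_eq pure_dot power_add)

lemma f_00_B:
  assumes "cls q b \<in> generate_ring (qsa q) Bgens"
  shows "f 0 0 \<bullet> b = f 0 0 \<bullet> const (eigval (cls q b))"
proof -
  have p: "pure x (cls q 1) = f 0 0 \<bullet> const x" for x
    using Ind.pt_balanced[of 1 "qsa_const q x" "\<one>\<^bsub>qsa q\<^esub>"] const_B[of x]
    by (simp add: f_eq pure_dot char_act_const) (simp add: cls_simps qsa_const_def)
  show ?thesis
    using Ind.pt_balanced[of 1 "cls q b" "\<one>\<^bsub>qsa q\<^esub>"] assms p[of "eigval (cls q b)"]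
    by (simp add: f_eq pure_dot char_act_eq) (simp add: cls_simps)
qed

lemma f_00_E: "f 0 0 \<bullet> E = \<zero>\<^bsub>M\<^esub>"
proof -
  have "cls q E \<in> generate_ring (qsa q) Bgens"
    by (rule generate_ring.incl) (simp add: Bgens_def qsa_gen_def)
  moreover have "eigval (cls q E) = 0" using eigvalI[OF cyc_gens(2)] by (simp add: qsa_gen_def)
  ultimately show ?thesis using f_00_B[of E] by (simp add: const_zero dot_simps)
qed

lemma f_00_X: "f 0 0 \<bullet> X \<in> line (f 0 0)"
proof -
  have "cls q X \<in> generate_ring (qsa q) Bgens"
    by (rule generate_ring.incl) (simp add: Bgens_def qsa_gen_def)
  then show ?thesis using f_00_B[of X] by (simp add: line_const)
qed

lemma f_00_Kl: "f 0 0 \<bullet> K ^ l = f 0 0 \<bullet> const lam2"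
proof -
  have "cls q (K ^ l) \<in> generate_ring (qsa q) Bgens"
    by (rule generate_ring.incl) (simp add: Bgens_def qsa_gen_def cls_simps)
  moreover have "eigval (cls q (K ^ l)) = lam2"
    using eigvalI[OF cyc_gens(4)] by (simp add: qsa_gen_def cls_simps)
  ultimately show ?thesis using f_00_B[of "K ^ l"] by simp
qed

text \<open>Reduction to \<open>n = 0\<close> for every generator that commutes with \<open>K\<close> up to a scalar.\<close>
lemma f_dot_comm:
  assumes "qcomm q K g" "f m 0 \<bullet> g \<in> line (f k 0)"
  shows "f m n \<bullet> g \<in> line (f k n)"
proof -
  have "f m n \<bullet> g = f m 0 \<bullet> K ^ n \<bullet> g" by (simp add: f_dot_K)
  also have "\<dots> \<in> line (f m 0 \<bullet> g \<bullet> K ^ n)"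
    by (rule line_qcomm[OF qcomm_power_left[OF assms(1)]]) simp
  finally have 1: "f m n \<bullet> g \<in> line (f m 0 \<bullet> g \<bullet> K ^ n)" .
  have "f m 0 \<bullet> g \<bullet> K ^ n \<in> line (f k 0 \<bullet> K ^ n)" using assms(2) by (rule line_dot) simp
  from line_trans[OF 1 this] show ?thesis by (simp add: f_dot_K)
qed

lemma f_Y: "f m n \<bullet> Y \<in> line (f (Suc m) n)"
proof (rule f_dot_comm[OF qcomms(1)])
  show "f m 0 \<bullet> Y \<in> line (f (Suc m) 0)"
    using f_dot_Y[of m 1] line_self[of "f (Suc m) 0"] by simp
qed

lemma f_m0_X: "f m 0 \<bullet> X \<in> line (f m 0)"
proof -
  have "f m 0 \<bullet> X = f 0 0 \<bullet> Y ^ m \<bullet> X" by (simp add: f_dot_Y)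
  also have "\<dots> \<in> line (f 0 0 \<bullet> X \<bullet> Y ^ m)"
    by (rule line_qcomm[OF qcomm_power_left[OF qcomms(4)]]) simp
  finally have 1: "f m 0 \<bullet> X \<in> line (f 0 0 \<bullet> X \<bullet> Y ^ m)" .
  have "f 0 0 \<bullet> X \<bullet> Y ^ m \<in> line (f 0 0 \<bullet> Y ^ m)" using f_00_X by (rule line_dot) simp
  from line_trans[OF 1 this] show ?thesis by (simp add: f_dot_Y)
qed

lemma f_X: "f m n \<bullet> X \<in> line (f m n)"
  by (rule f_dot_comm[OF qcomms(2) f_m0_X])

text \<open>The relation for \<open>E Y\<close>, solved for \<open>Y E\<close>.\<close>
lemma cls_YE: "cls q (Y * E) = cls q (E * Y * const q + X * const (- q))"
proof -
  have "cls q ((E * Y) * const q) = cls q ((X + const (q powi (-1)) * Y * E) * const q)"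
    by (intro cls_mult_cong qsa_rels_cls refl)
  also have "(X + const (q powi (-1)) * Y * E) * const q = X * const q + const (q powi (-1)) * ((Y * E) * const q)"
    by (simp only: distrib_right mult.assoc)
  also have "\<dots> = X * const q + const (q powi (-1)) * (const q * (Y * E))"
    by (simp only: const_central[of q "Y * E"])
  also have "\<dots> = X * const q + const (q powi (-1) * q) * (Y * E)"
    by (simp only: const_mult[symmetric] mult.assoc)
  finally have "cls q (E * Y * const q) = cls q (X * const q + Y * E)"
    using q0 by (simp add: power_int_minus const_one)
  then have "cls q (E * Y * const q + X * const (- q)) = cls q (X * const q + Y * E + X * const (- q))"
    by (metis cls_simps(3))
  moreover have "const q + const (- q) = 0" by (simp add: const_def single_add[symmetric])
  then have "X * const q + X * const (- q) = 0" by (metis distrib_left mult_zero_right)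
  then have "X * const q + Y * E + X * const (- q) = Y * E"
    by (simp only: add.commute[of "X * const q" "Y * E"] add.assoc add_0_right)
  ultimately show ?thesis by simp
qed

text \<open>Induction on \<open>m\<close>: \<open>f(m + 1, 0) E = f(m, 0) Y E\<close>, and \<open>Y E\<close> is a combination of \<open>E Y\<close> and
  \<open>X\<close>, both of which return to the line of \<open>f(m, 0)\<close>.\<close>
lemma f_m0_E: "f (Suc m) 0 \<bullet> E \<in> line (f m 0)"
proof (induction m)
  case 0
  have "f (Suc 0) 0 \<bullet> E = f 0 0 \<bullet> (Y * E)" using f_dot_Y[of 0 1] by (simp flip: dot_simps(2))
  also have "\<dots> = f 0 0 \<bullet> E \<bullet> (Y * const q) \<oplus>\<^bsub>M\<^esub> f 0 0 \<bullet> X \<bullet> const (- q)"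
    by (simp add: cls_YE dot_simps mult.assoc)
  also have "\<dots> = f 0 0 \<bullet> X \<bullet> const (- q)"
    by (simp add: f_00_E M.ract_zero_left cls_simps dot_simps)
  also have "\<dots> \<in> line (f 0 0)" using line_trans[OF line_const f_00_X] by simp
  finally show ?case .
next
  case (Suc m)
  have "f (Suc (Suc m)) 0 \<bullet> E = f (Suc m) 0 \<bullet> (Y * E)"
    using f_dot_Y[of "Suc m" 1] by (simp flip: dot_simps(2))
  also have "\<dots> = f (Suc m) 0 \<bullet> E \<bullet> Y \<bullet> const q \<oplus>\<^bsub>M\<^esub> f (Suc m) 0 \<bullet> X \<bullet> const (- q)"
    by (simp add: cls_YE dot_simps mult.assoc)
  also have "\<dots> \<in> line (f (Suc m) 0)"
  proof (rule line_add)
    have "f (Suc m) 0 \<bullet> E \<bullet> Y \<in> line (f m 0 \<bullet> Y)" using Suc by (rule line_dot) simp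
    from line_trans[OF this f_Y] show "f (Suc m) 0 \<bullet> E \<bullet> Y \<bullet> const q \<in> line (f (Suc m) 0)"
      using line_trans[OF line_const] by simp
    show "f (Suc m) 0 \<bullet> X \<bullet> const (- q) \<in> line (f (Suc m) 0)"
      using line_trans[OF line_const f_X] by simp
  qed simp
  finally show ?case .
qed

lemma f_E: "f m n \<bullet> E \<in> line (f (m - 1) n)"
proof (cases m)
  case 0
  have "f 0 0 \<bullet> E \<in> line (f 0 0)" by (simp add: f_00_E line_zero)
  then show ?thesis using f_dot_comm[OF qcomms(3)] by (simp add: 0)
next
  case (Suc k)
  then show ?thesis using f_dot_comm[OF qcomms(3) f_m0_E] by simp
qed

lemma f_l_in_line: "f m l \<in> line (f m 0)"
proof -
  have "f m l = f 0 0 \<bullet> Y ^ m \<bullet> K ^ l" by (simp add: f_dot_Y f_dot_K)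
  also have "\<dots> \<in> line (f 0 0 \<bullet> K ^ l \<bullet> Y ^ m)"
    by (rule line_qcomm[OF qcomm_power_left[OF qcomm_power_right[OF qcomms(5)]]]) simp
  finally have 1: "f m l \<in> line (f 0 0 \<bullet> K ^ l \<bullet> Y ^ m)" .
  have "f 0 0 \<bullet> K ^ l \<bullet> Y ^ m \<in> line (f 0 0 \<bullet> Y ^ m)"
    unfolding f_00_Kl by (rule line_dot) (simp_all add: line_const)
  from line_trans[OF 1 this] show ?thesis by (simp add: f_dot_Y)
qed

text \<open>The converse of \<open>f_l_in_line\<close>; it holds because \<open>lam2\<close> is invertible, and it is what allows to compute \<open>f(m, 0) K\<^sup>-\<^sup>1\<close>.\<close>
lemma f_0_in_line: "f m 0 \<in> line (f m l)"
proof -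
  have "f 0 0 \<bullet> K ^ l \<bullet> const (inverse lam2) = f 0 0"
    unfolding f_00_Kl using lam by (simp add: dot_simps const_mult const_one)
  then have "f 0 0 \<in> line (f 0 0 \<bullet> K ^ l)" using line_const[of "f 0 0 \<bullet> K ^ l" "inverse lam2"] by simp
  then have "f 0 0 \<bullet> Y ^ m \<in> line (f 0 0 \<bullet> K ^ l \<bullet> Y ^ m)" by (rule line_dot) (simp add: dot_simps)
  moreover have "f 0 0 \<bullet> K ^ l \<bullet> Y ^ m \<in> line (f 0 0 \<bullet> Y ^ m \<bullet> K ^ l)"
    by (rule line_qcomm[OF qcomm_power_left[OF qcomm_power_right[OF qcomms(1)]]]) simp
  ultimately have "f 0 0 \<bullet> Y ^ m \<in> line (f 0 0 \<bullet> Y ^ m \<bullet> K ^ l)"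
    by (rule line_trans) (simp add: dot_simps)
  then show ?thesis by (simp add: f_dot_Y f_dot_K)
qed

lemma f_Kinv: "f m n \<bullet> K' \<in> line (f m (if n = 0 then l - 1 else n - 1))"
proof -
  have KK: "f m (Suc k) \<bullet> K' = f m k" for k
  proof -
    have "f m (Suc k) \<bullet> K' = f m k \<bullet> (K * K')"
      using f_dot_K[of m k 1] by (simp flip: dot_simps(2))
    then show ?thesis by (simp add: qsa_rels_cls dot_simps)
  qed
  show ?thesis
  proof (cases n)
    case 0
    obtain k where k: "l = Suc k" using l by (cases l) auto
    have "f m 0 \<bullet> K' \<in> line (f m l \<bullet> K')" using f_0_in_line by (rule line_dot) simp
    then show ?thesis using 0 KK[of k] by (simp add: k)
  qed (simp add: KK line_self)
qed

lemma f_letter_in_line: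
  assumes "n < l"
  shows "\<exists>m' n'. n' < l \<and> f m n \<bullet> letter g \<in> line (f m' n')"
proof (cases g)
  case GK
  have K: "f m n \<bullet> K = f m (Suc n)" using f_dot_K[of m n 1] by simp
  show ?thesis
  proof (cases "Suc n < l")
    case True
    then show ?thesis using K GK line_self[of "f m (Suc n)"] by auto
  next
    case False
    then have "Suc n = l" using assms by simp
    then show ?thesis using K GK f_l_in_line[of m] l by (intro exI[of _ m] exI[of _ 0]) auto
  qed
next
  case GKinv
  then show ?thesis using f_Kinv[of m n] assms
    by (intro exI[of _ m] exI[of _ "if n = 0 then l - 1 else n - 1"]) auto
qed (use assms f_E f_X f_Y in blast)+

section \<open>Spans of basis vectors\<close>

definition fspan :: "(nat \<times> nat) set \<Rightarrow> 'k verma_elt set" where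
  "fspan A = generate (add_monoid M) {f m n \<bullet> const c | m n c. (m, n) \<in> A \<and> n < l}"

lemma fspan_subgroup: "subgroup (fspan A) (add_monoid M)"
  unfolding fspan_def by (rule M.M.add.generate_is_subgroup) (auto simp: dot_simps)

lemma fspan_closed:
  "fspan A \<subseteq> carrier M" "\<zero>\<^bsub>M\<^esub> \<in> fspan A" "x \<in> fspan A \<Longrightarrow> y \<in> fspan A \<Longrightarrow> x \<oplus>\<^bsub>M\<^esub> y \<in> fspan A"
  "x \<in> fspan A \<Longrightarrow> \<ominus>\<^bsub>M\<^esub> x \<in> fspan A" "(m, n) \<in> A \<Longrightarrow> n < l \<Longrightarrow> f m n \<bullet> const c \<in> fspan A"
proof -
  show "(m, n) \<in> A \<Longrightarrow> n < l \<Longrightarrow> f m n \<bullet> const c \<in> fspan A"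
    unfolding fspan_def by (rule generate.incl) blast
qed (use subgroup.subset[OF fspan_subgroup] subgroup.one_closed[OF fspan_subgroup]
    subgroup.m_closed[OF fspan_subgroup] subgroup.m_inv_closed[OF fspan_subgroup] in
    \<open>auto simp: a_inv_def\<close>)

lemma fspan_induct [consumes 1, case_names zero gen add]:
  assumes "x \<in> fspan A" and "P \<zero>\<^bsub>M\<^esub>" and "\<And>m n c. (m, n) \<in> A \<Longrightarrow> n < l \<Longrightarrow> P (f m n \<bullet> const c)"
    and "\<And>x y. x \<in> fspan A \<Longrightarrow> y \<in> fspan A \<Longrightarrow> P x \<Longrightarrow> P y \<Longrightarrow> P (x \<oplus>\<^bsub>M\<^esub> y)"
  shows "P x"
  using assms(1) unfolding fspan_def
proof (induction rule: generate.induct)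
  case one
  then show ?case using assms(2) by simp
next
  case (incl h)
  then show ?case using assms(3) by blast
next
  case (inv h)
  then obtain m n c where h: "h = f m n \<bullet> const c" "(m, n) \<in> A" "n < l" by blast
  have "- const c = (const (- c) :: (gen, 'k) free_alg)" by (simp add: const_def single_uminus)
  then have "inv\<^bsub>add_monoid M\<^esub> h = f m n \<bullet> const (- c)"
    using dot_minus[of "f m n" "const c"] h(1) by (simp add: a_inv_def)
  then show ?case using assms(3)[OF h(2,3)] by simp
next
  case (eng h1 h2)
  then show ?case using assms(4)[unfolded fspan_def] by simp
qed

lemma fspan_dot_letter:
  assumes "x \<in> fspan UNIV" shows "x \<bullet> letter g \<in> fspan UNIV"
  using assms
proof (induction rule: fspan_induct)
  case zero
  then show ?case by (simp add: M.ract_zero_left cls_simps(1) fspan_closed)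
next
  case (gen m n c)
  obtain m' n' where n': "n' < l" "f m n \<bullet> letter g \<in> line (f m' n')" using f_letter_in_line[OF gen(2)] by blast
  have "f m n \<bullet> const c \<bullet> letter g = f m n \<bullet> letter g \<bullet> const c"
    by (simp add: dot_simps const_central)
  also have "\<dots> \<in> line (f m' n')" by (rule line_trans[OF line_const n'(2)]) simp
  finally show ?case using fspan_closed(5)[OF UNIV_I n'(1)] by (auto simp: line_def)
next
  case (add x y)
  then have "x \<in> carrier M" "y \<in> carrier M" using fspan_closed(1) by blast+
  then show ?case using add by (simp add: dot_simps fspan_closed)
qed

lemma fspan_dot_const:
  assumes "x \<in> fspan A" shows "x \<bullet> const c \<in> fspan A"
  using assms
proof (induction rule: fspan_induct)
  case zero
  then show ?case by (simp add: M.ract_zero_left cls_simps(1) fspan_closed)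
next
  case (gen m n d)
  then show ?case by (simp add: dot_simps const_mult fspan_closed)
next
  case (add x y)
  then have "x \<in> carrier M" "y \<in> carrier M" using fspan_closed(1) by blast+
  then show ?case using add by (simp add: dot_simps fspan_closed)
qed

lemma fspan_dot:
  assumes "x \<in> fspan UNIV" shows "x \<bullet> a \<in> fspan UNIV"
proof (induction a rule: free_alg_induct)
  case zero
  have "x \<in> carrier M" using assms fspan_closed(1) by blast
  then show ?case by (simp add: dot_simps fspan_closed)
next
  case (single w c)
  have "x \<bullet> Poly_Mapping.single (Word gs) c \<in> fspan UNIV" for gs
    using assms
  proof (induction gs arbitrary: x)
    case Nil
    then show ?case using fspan_dot_const[of x UNIV c] by (simp add: const_def zero_free_word_def)
  next
    case (Cons g gs)
    have "Poly_Mapping.single (Word (g # gs)) c = letter g * Poly_Mapping.single (Word gs) c"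
      by (simp add: letter_def mult_single plus_free_word_def)
    moreover have "x \<in> carrier M" using Cons.prems fspan_closed(1) by blast
    ultimately have "x \<bullet> Poly_Mapping.single (Word (g # gs)) c
        = x \<bullet> letter g \<bullet> Poly_Mapping.single (Word gs) c"
      by (simp add: dot_simps)
    then show ?case using Cons.IH[OF fspan_dot_letter[OF Cons.prems]] by simp
  qed
  from this[of "letters w"] show ?case by simp
next
  case (add a b)
  moreover have "x \<in> carrier M" using assms fspan_closed(1) by blast
  ultimately show ?case by (simp add: dot_simps fspan_closed)
qed

text \<open>The span of all \<open>f(m, n)\<close> is stable under the generators by \<open>f_letter_in_line\<close>, and every pure tensor
  arises from \<open>f(0, 0)\<close> by acting with an algebra element.\<close>
lemma fspan_UNIV: "fspan UNIV = carrier M"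
proof
  have f00: "f 0 0 \<in> fspan UNIV"
    using fspan_closed(5)[of 0 0 UNIV 1] l dot_simps(4)[of "f 0 0"] by (simp add: const_one)
  show "carrier M \<subseteq> fspan UNIV"
  proof
    fix C assume "C \<in> carrier M"
    then show "C \<in> fspan UNIV"
      unfolding verma_eq
    proof (induction C rule: Ind.I_induct)
      case zero
      then show ?case using fspan_closed(2) by (simp add: verma_eq)
    next
      case (pure x s)
      then obtain a where a: "s = cls q a" by (auto simp: carrier_qsa)
      have "pure x (cls q a) = pure 1 (qsa_const q x \<otimes>\<^bsub>qsa q\<^esub> cls q a)"
        using Ind.pt_balanced[of 1 "qsa_const q x" "cls q a"] const_B[of x]
        by (simp add: char_act_const cls_simps)
      also have "\<dots> = f 0 0 \<bullet> (const x * a)"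
        by (simp add: f_eq pure_dot qsa_const_def cls_simps)
      also have "\<dots> \<in> fspan UNIV" by (rule fspan_dot[OF f00])
      finally show ?case by (simp add: a)
    next
      case (diff C D)
      then show ?case using fspan_closed(3,4) by (simp add: a_minus_def verma_eq)
    qed
  qed
qed (rule fspan_closed)

section \<open>Linear independence of the basis vectors\<close>

lemma coords_f: "coords (f m n) = (\<lambda>m' k. if m' = m then cyc 0 (k - int n) else 0)"
proof -
  have "coords (f m n) = V.act cyc (Y ^ m * K ^ n)"
    by (simp add: f_eq coords_spec cls_simps)
  also have "\<dots> = (\<lambda>m' k. if m' = m then cyc 0 (k - int n) else 0)"
    unfolding V.act_mult act_K_power act_Y_power
    by (intro ext) (auto simp: cyc_def q_powi_dvd)
  finally show ?thesis .
qed

lemma coords_const: "x \<in> carrier M \<Longrightarrow> coords (x \<bullet> const c) = coeff_scale c (coords x)"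
  by (simp add: coords_dot)

lemma coords_f_delta:
  assumes "n < l" "n' < l"
  shows "coords (f m n \<bullet> const c) m' (int n') = (if m = m' \<and> n = n' then c else 0)"
proof -
  have "int l dvd int n' - int n \<longleftrightarrow> n = n'"
  proof
    assume "int l dvd int n' - int n"
    moreover have "\<bar>int n' - int n\<bar> < int l" using assms by linarith
    ultimately show "n = n'" using dvd_imp_le_int[of "int n' - int n" "int l"] by fastforce
  qed simp
  then show ?thesis
    by (auto simp: coords_const coords_f coeff_scale_def cyc_00 cyc_def)
qed

lemma coords_periodic:
  assumes "x \<in> carrier M"
  shows "coords x m (n + int l) = inverse lam2 * coords x m n"
  using assms unfolding fspan_UNIV[symmetric]
proof (induction rule: fspan_induct)
  case (gen m' n' c)
  then show ?case
    using cyc_shift(2)[of 0 "n - int n'"]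
    by (auto simp: coords_const coords_f coeff_scale_def algebra_simps)
next
  case (add x y)
  then have "x \<in> carrier M" "y \<in> carrier M" using fspan_closed(1) by blast+
  then show ?case using add by (simp add: coords_spec algebra_simps)
qed (simp add: coords_zero)

definition component :: "'k verma_elt \<Rightarrow> nat \<times> nat \<Rightarrow> 'k verma_elt" where
  "component x = (\<lambda>(m, n). f m n \<bullet> const (coords x m (int n)))"

lemma component_closed: "component x \<in> J \<rightarrow> carrier M"
  by (auto simp: component_def dot_simps)

text \<open>Every element is the sum of its components over any finite index set that is large enough. Allowing
  all larger sets makes the statement stable under addition: for \<open>x + y\<close> the union of the two index sets works.\<close>
lemma verma_expansion:
  assumes "x \<in> carrier M"
  shows "\<exists>J0. finite J0 \<and> J0 \<subseteq> UNIV \<times> {..<l} \<and> (\<forall>J. finite J \<and> J0 \<subseteq> J \<and> J \<subseteq> UNIV \<times> {..<l} \<longrightarrow> x = finsum M (component x) J)"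
  using assms unfolding fspan_UNIV[symmetric]
proof (induction rule: fspan_induct)
  case zero
  have "component \<zero>\<^bsub>M\<^esub> = (\<lambda>_. \<zero>\<^bsub>M\<^esub>)"
    by (simp add: component_def coords_zero const_zero dot_simps fun_eq_iff)
  then show ?case by auto
next
  case (gen m n c)
  let ?x = "f m n \<bullet> const c"
  have "?x = finsum M (component ?x) J" if J: "finite J" "{(m, n)} \<subseteq> J" "J \<subseteq> UNIV \<times> {..<l}" for J
  proof -
    have "component ?x j = (if (m, n) = j then ?x else \<zero>\<^bsub>M\<^esub>)" if "j \<in> J" for j
    proof -
      obtain m' n' where j: "j = (m', n')" "n' < l" using \<open>j \<in> J\<close> J(3) by auto
      have "coords ?x m' (int n') = (if m = m' \<and> n = n' then c else 0)"
        using coords_f_delta[OF gen(2) j(2)] .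
      then show ?thesis by (cases "m = m' \<and> n = n'") (auto simp: j(1) component_def const_zero dot_simps(5))
    qed
    note eq = this
    have "finsum M (component ?x) J = finsum M (\<lambda>j. if (m, n) = j then ?x else \<zero>\<^bsub>M\<^esub>) J"
    proof (rule M.M.add.finprod_cong'[OF refl])
      show "(\<lambda>j. if (m, n) = j then ?x else \<zero>\<^bsub>M\<^esub>) \<in> J \<rightarrow> carrier M" by (simp add: dot_simps(1))
    qed (rule eq)
    also have "\<dots> = ?x"
      using J by (intro M.M.add.finprod_singleton) (auto simp: dot_simps(1))
    finally show ?thesis by simp
  qed
  note sum = this
  show ?case
  proof (intro exI[of _ "{(m, n)}"] conjI allI impI)
    show "{(m, n)} \<subseteq> UNIV \<times> {..<l}" using gen by auto
  qed (simp, rule sum, blast+)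
next
  case (add x y)
  have xy: "x \<in> carrier M" "y \<in> carrier M" using add.hyps fspan_closed(1) by blast+
  let ?S = "UNIV \<times> {..<l}"
  obtain Jx where Jx: "finite Jx" "Jx \<subseteq> ?S" "\<forall>J. finite J \<and> Jx \<subseteq> J \<and> J \<subseteq> ?S \<longrightarrow> x = finsum M (component x) J"
    using add.IH(1) by (elim exE conjE) (rule that)
  obtain Jy where Jy: "finite Jy" "Jy \<subseteq> ?S" "\<forall>J. finite J \<and> Jy \<subseteq> J \<and> J \<subseteq> ?S \<longrightarrow> y = finsum M (component y) J"
    using add.IH(2) by (elim exE conjE) (rule that)
  have "x \<oplus>\<^bsub>M\<^esub> y = finsum M (component (x \<oplus>\<^bsub>M\<^esub> y)) J"
    if J: "finite J" "Jx \<union> Jy \<subseteq> J" "J \<subseteq> UNIV \<times> {..<l}" for J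
  proof -
    have "const a + const b = (const (a + b) :: (gen, 'k) free_alg)" for a b by (simp add: const_def single_add)
    then have "f m n \<bullet> const (a + b) = f m n \<bullet> const a \<oplus>\<^bsub>M\<^esub> f m n \<bullet> const b" for m n a b
      using dot_simps(3)[of "f m n" "const a" "const b"] by simp
    then have "component (x \<oplus>\<^bsub>M\<^esub> y) = (\<lambda>j. component x j \<oplus>\<^bsub>M\<^esub> component y j)"
      unfolding component_def coords_spec(1)[OF xy] by (simp add: case_prod_unfold)
    then have "finsum M (component (x \<oplus>\<^bsub>M\<^esub> y)) J = finsum M (\<lambda>j. component x j \<oplus>\<^bsub>M\<^esub> component y j) J"
      by (rule arg_cong)
    also have "\<dots> = finsum M (component x) J \<oplus>\<^bsub>M\<^esub> finsum M (component y) J"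
      by (rule M.M.finsum_addf) (rule component_closed)+
    also have "\<dots> = x \<oplus>\<^bsub>M\<^esub> y" using Jx(3)[rule_format, of J, symmetric] Jy(3)[rule_format, of J, symmetric] J
      by (simp only: Un_subset_iff)
    finally show ?thesis by simp
  qed
  note sum = this
  show ?case
  proof (intro exI[of _ "Jx \<union> Jy"] conjI allI impI)
    show "finite (Jx \<union> Jy)" "Jx \<union> Jy \<subseteq> UNIV \<times> {..<l}" using Jx(1,2) Jy(1,2) by auto
  qed (rule sum, blast+)
qed

text \<open>Components at indices outside \<open>A\<close> vanish, so the expansion involves only basis vectors with index in \<open>A\<close>.\<close>
lemma fspan_coords:
  assumes "x \<in> carrier M" and "\<And>m n. (m, n) \<notin> A \<Longrightarrow> n < l \<Longrightarrow> coords x m (int n) = 0"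
  shows "x \<in> fspan A"
proof -
  obtain J where J: "finite J" "J \<subseteq> UNIV \<times> {..<l}"
    and all: "\<forall>J'. finite J' \<and> J \<subseteq> J' \<and> J' \<subseteq> UNIV \<times> {..<l} \<longrightarrow> x = finsum M (component x) J'"
    using verma_expansion[OF assms(1)] by (elim exE conjE) (rule that)
  have "finsum M (component x) J' \<in> fspan A" if "J' \<subseteq> J" for J'
  proof -
    from that J(1) have "finite J'" by (rule finite_subset)
    then show ?thesis using that
    proof (induction J' rule: finite_induct)
      case empty
      then show ?case by (simp add: fspan_closed)
    next
      case (insert j J')
      have "component x j \<in> fspan A"
      proof (cases "j \<in> A")
        case True
        then show ?thesis using insert.prems J(2) by (auto simp: component_def intro!: fspan_closed(5))
      next
        case False
        then show ?thesis using insert.prems J(2) assms(2)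
          by (auto simp: component_def const_zero dot_simps fspan_closed(2) split: prod.split)
      qed
      then show ?case using insert component_closed[of x]
        by (subst M.M.finsum_insert) (auto simp: fspan_closed(3) Pi_iff)
    qed
  qed
  then have "finsum M (component x) J \<in> fspan A" by simp
  moreover have "x = finsum M (component x) J" using all[rule_format, of J] J by simp
  ultimately show ?thesis by (rule back_subst[OF _ sym])
qed

text \<open>An element with vanishing coordinates lies in the span of the empty set.\<close>
lemma coords_inj:
  assumes "x \<in> carrier M" "y \<in> carrier M" "coords x = coords y"
  shows "x = y"
proof -
  have xy: "x \<ominus>\<^bsub>M\<^esub> y \<in> carrier M" using assms by simp
  then have "x \<ominus>\<^bsub>M\<^esub> y \<in> fspan {}"
    by (rule fspan_coords) (use assms in \<open>simp add: coords_diff\<close>)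
  then have "x \<ominus>\<^bsub>M\<^esub> y = \<zero>\<^bsub>M\<^esub>"
    by (induction rule: fspan_induct) auto
  moreover have "x = (x \<ominus>\<^bsub>M\<^esub> y) \<oplus>\<^bsub>M\<^esub> y"
    using assms by (simp add: a_minus_def M.M.a_assoc M.M.l_neg)
  ultimately show ?thesis using assms(2) by simp
qed

section \<open>Degree filtration\<close>

definition deg_ge :: "nat \<Rightarrow> 'k verma_elt set" where
  "deg_ge N = {x \<in> carrier M. \<forall>m<N. \<forall>n. coords x m n = 0}"

lemma fspan_deg_ge: "fspan {(m, n). N \<le> m} = deg_ge N"
proof (intro equalityI subsetI)
  fix x assume "x \<in> fspan {(m, n). N \<le> m}"
  then show "x \<in> deg_ge N"
  proof (induction rule: fspan_induct)
    case zero
    then show ?case by (simp add: deg_ge_def coords_zero)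
  next
    case (gen m n c)
    then show ?case by (auto simp: deg_ge_def dot_simps coords_const coords_f coeff_scale_def)
  next
    case (add x y)
    then show ?case by (simp add: deg_ge_def coords_spec)
  qed
next
  fix x assume "x \<in> deg_ge N"
  then show "x \<in> fspan {(m, n). N \<le> m}"
    by (intro fspan_coords) (auto simp: deg_ge_def)
qed

lemma verma_sub_eq: "verma_sub q l lam1 lam2 p = deg_ge (p * l)"
proof -
  have "{x \<odot>\<^sub>r\<^bsub>M\<^esub> qsa_const q c | x c. x \<in> {f (p * l + i) n | i n. n \<le> l - 1}}
    = {f m n \<bullet> const c | m n c. (m, n) \<in> {(m, n). p * l \<le> m} \<and> n < l}" (is "?A = ?B")
  proof (intro equalityI subsetI)
    fix y assume "y \<in> ?A"
    then obtain i n c where "y = f (p * l + i) n \<bullet> const c" "n \<le> l - 1" by (auto simp: qsa_const_def)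
    moreover have "n < l" using \<open>n \<le> l - 1\<close> l by linarith
    ultimately show "y \<in> ?B" by force
  next
    fix y assume "y \<in> ?B"
    then obtain m n c where y: "y = f m n \<bullet> const c" "p * l \<le> m" "n < l" by blast
    then obtain i where "m = p * l + i" using le_Suc_ex by blast
    then have "f m n \<in> {f (p * l + i) n | i n. n \<le> l - 1}" using y(3) by force
    then show "y \<in> ?A" using y(1) unfolding qsa_const_def by blast
  qed
  then show ?thesis unfolding verma_sub_def lin_span_def fspan_deg_ge[symmetric] fspan_def by simp
qed

text \<open>This is where oddness of \<open>l\<close> enters: \<open>l\<close> divides \<open>2 m\<close> only if it divides \<open>m\<close>.\<close>
lemma low_coeff_zero_iff: "low_coeff q m = 0 \<longleftrightarrow> l dvd m"
proof -
  have "q ^ k = q ^ (k mod l)" for k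
    using ql by (metis div_mult_mod_eq mult.commute mult.left_neutral power_add power_mult power_one)
  moreover have "q ^ (k mod l) = 1 \<longleftrightarrow> k mod l = 0" for k
    using qk[of "k mod l"] l by auto
  ultimately have "q ^ k = 1 \<longleftrightarrow> l dvd k" for k by (metis dvd_eq_mod_eq_0)
  then have "low_coeff q m = 0 \<longleftrightarrow> l dvd 2 * m" by (simp add: low_coeff_eq_0_iff[OF q0 q2])
  also have "\<dots> \<longleftrightarrow> l dvd m"
    using l(2) by (simp add: coprime_dvd_mult_right_iff)
  finally show ?thesis .
qed

text \<open>Only \<open>E\<close> lowers degrees, and its scalar vanishes at the degree \<open>p l\<close>, where it would leave the set.\<close>
lemma deg_ge_submodule: "right_submodule (deg_ge (p * l)) (qsa q) M"
proof (rule M.submoduleI)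
  show "deg_ge (p * l) \<subseteq> carrier M" "deg_ge (p * l) \<noteq> {}"
    using fspan_closed(1,2)[of "{(m, n). p * l \<le> m}"] by (auto simp: fspan_deg_ge)
  show "x \<oplus>\<^bsub>M\<^esub> y \<in> deg_ge (p * l)" if "x \<in> deg_ge (p * l)" "y \<in> deg_ge (p * l)" for x y
    using that fspan_closed(3) by (simp flip: fspan_deg_ge)
  show "\<ominus>\<^bsub>M\<^esub> x \<in> deg_ge (p * l)" if "x \<in> deg_ge (p * l)" for x
    using that fspan_closed(4) by (simp flip: fspan_deg_ge)
  fix x s assume x: "x \<in> deg_ge (p * l)" and s: "s \<in> carrier (qsa q)"
  obtain a where a: "s = cls q a" using s by (auto simp: carrier_qsa)
  have "V.act (coords x) a \<in> {y. \<forall>m<p * l. \<forall>n. y m n = 0}"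
  proof (rule V.act_invariant)
    fix g y assume y: "y \<in> {y. \<forall>m<p * l. \<forall>n. y (m::nat) (n::int) = (0::'k)}"
    have "low_coeff q (Suc m) * y (Suc m) n = 0" if "m < p * l" for m n
    proof (cases "Suc m = p * l")
      case True
      then have "low_coeff q (Suc m) = 0" by (simp only: low_coeff_zero_iff) simp
      then show ?thesis by simp
    next
      case False
      then show ?thesis using that y by simp
    qed
    then show "coeff_step q lam1 g y \<in> {y. \<forall>m<p * l. \<forall>n. y m n = 0}"
      using y by (cases g) (auto simp: mult.assoc)
  qed (use x in \<open>auto simp: deg_ge_def coeff_scale_def\<close>)
  then show "x \<odot>\<^sub>r\<^bsub>M\<^esub> s \<in> deg_ge (p * l)"
    using x by (simp add: a deg_ge_def dot_simps coords_dot)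
qed

end

section \<open>Submodules outside the positive degrees\<close>

lemma twisted_periodic_zero_iff:
  fixes y :: "int \<Rightarrow> 'a::field"
  assumes "\<And>n. y (n + N) = c * y n" and "c \<noteq> 0"
  shows "y n = 0 \<longleftrightarrow> y (n mod N) = 0"
proof -
  have "y (m + k * N) = 0 \<longleftrightarrow> y m = 0" for m k
  proof (induction k rule: int_induct[where k = 0])
    case (step1 i)
    then show ?case using assms(1)[of "m + i * N"] assms(2) by (simp add: algebra_simps)
  next
    case (step2 i)
    then show ?case using assms(1)[of "m + (i - 1) * N"] assms(2) by (simp add: algebra_simps)
  qed simp
  from this[of "n mod N" "n div N"] show ?thesis by simp
qed

context verma_params
begin

definition periodic :: "(nat \<Rightarrow> int \<Rightarrow> 'k) \<Rightarrow> bool" where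
  "periodic x \<longleftrightarrow> (\<forall>m n. x m (n + int l) = inverse lam2 * x m n)"

text \<open>On twisted periodic functions one period decides about vanishing, so the support is
  counted within \<open>0, \<dots>, l - 1\<close>.\<close>
definition supp :: "(int \<Rightarrow> 'k) \<Rightarrow> nat set" where
  "supp y = {k. k < l \<and> y (int k) \<noteq> 0}"

lemma finite_supp: "finite (supp y)"
  by (auto simp: supp_def)

lemma periodic_zero_iff: "periodic x \<Longrightarrow> x m n = 0 \<longleftrightarrow> nat (n mod int l) \<notin> supp (x m)"
  using twisted_periodic_zero_iff[of "x m" "int l" "inverse lam2" n] lam l
  by (auto simp: periodic_def supp_def nat_less_iff)

lemma exists_nonzero_degree_0:
  assumes step: "\<And>g x. x \<in> W \<Longrightarrow> coeff_step q lam1 g x \<in> W"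
    and "w \<in> W" "w m n \<noteq> 0" "m < l"
  shows "\<exists>w\<in>W. w 0 n \<noteq> 0"
  using assms(2-4)
proof (induction m arbitrary: w)
  case 0
  then show ?case by blast
next
  case (Suc m)
  have "\<not> l dvd Suc m" using Suc.prems(3) by (simp add: nat_dvd_not_less)
  then have "coeff_step q lam1 GE w m n \<noteq> 0"
    using Suc.prems(2) lam q0 by (simp add: low_coeff_zero_iff)
  then show ?case using Suc.IH[OF step[OF Suc.prems(1), of GE]] Suc.prems(3) by linarith
qed

lemma q_powi_inj:
  assumes "n1 < l" "n2 < l" "q powi int n1 = q powi int n2"
  shows "n1 = n2"
proof (rule ccontr)
  have *: "q ^ n \<noteq> q ^ m" if "n < m" "m < l" for n m
  proof
    assume "q ^ n = q ^ m"
    moreover have "q ^ m = q ^ n * q ^ (m - n)" using that by (simp flip: power_add)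
    ultimately have "q ^ (m - n) = 1" using q0 by simp
    then show False using qk[of "m - n"] that by simp
  qed
  assume "n1 \<noteq> n2"
  then show False using *[of n1 n2] *[of n2 n1] assms by (auto simp: nat_neq_iff)
qed

text \<open>\<open>X\<close> has the distinct eigenvalues \<open>lam1 q\<^sup>n\<close> in degree \<open>0\<close>; applying \<open>X\<close> minus one of these
  eigenvalues removes one index from the support while keeping all others.\<close>
lemma exists_isolated:
  assumes step: "\<And>g x. x \<in> W \<Longrightarrow> coeff_step q lam1 g x \<in> W"
    and diff: "\<And>x y. x \<in> W \<Longrightarrow> y \<in> W \<Longrightarrow> x - y \<in> W"
    and scale: "\<And>c x. x \<in> W \<Longrightarrow> coeff_scale c x \<in> W"
    and "w \<in> W" "supp (w 0) \<noteq> {}"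
  shows "\<exists>w\<in>W. \<exists>n. supp (w 0) = {n}"
  using assms(4,5)
proof (induction "card (supp (w 0))" arbitrary: w rule: less_induct)
  case less
  obtain n1 where n1: "n1 \<in> supp (w 0)" using less.prems by blast
  show ?case
  proof (cases "supp (w 0) = {n1}")
    case True
    then show ?thesis using less.prems by blast
  next
    case False
    then obtain n2 where n2: "n2 \<in> supp (w 0)" "n2 \<noteq> n1" using n1 by blast
    define w' where "w' = coeff_step q lam1 GX w - coeff_scale (lam1 * q powi int n1) w"
    have w': "w' \<in> W" unfolding w'_def by (intro diff step scale less.prems)
    have val: "w' 0 n = lam1 * (q powi n - q powi int n1) * w 0 n" for n
      by (simp add: w'_def coeff_scale_def algebra_simps)
    have "supp (w' 0) \<subseteq> supp (w 0) - {n1}" by (auto simp: supp_def val)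
    then have "card (supp (w' 0)) < card (supp (w 0))"
      using n1 by (intro psubset_card_mono finite_supp) blast
    moreover have "n2 \<in> supp (w' 0)"
      using n1 n2 lam q_powi_inj[of n2 n1] by (auto simp: supp_def val)
    ultimately show ?thesis using less.hyps[OF _ w'] by blast
  qed
qed

lemma shift_closed:
  assumes step: "\<And>g x. x \<in> W \<Longrightarrow> coeff_step q lam1 g x \<in> W" and "w \<in> W"
  shows "(\<lambda>m n. w m (n - i)) \<in> W"
proof (induction i rule: int_induct[where k = 0])
  case base
  then show ?case using assms(2) by simp
next
  case (step1 i)
  then show ?case using step[OF step1(2), of GK] by (simp add: algebra_simps)
next
  case (step2 i)
  then show ?case using step[OF step2(2), of GKinv] by (simp add: algebra_simps)
qed

lemma raise_closed:
  assumes step: "\<And>g x. x \<in> W \<Longrightarrow> coeff_step q lam1 g x \<in> W" and "w \<in> W"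
  shows "V.act w (Y ^ j) \<in> W"
proof (induction j)
  case (Suc j)
  then show ?case using step[OF Suc, of GY] by (simp only: power_Suc2 V.act_mult V.act_letter)
qed (use assms in simp)

text \<open>The central argument, in terms of coefficient functions: \<open>L\<close> stands for the image of \<open>M\<close> and \<open>W\<close> for that of a
  submodule. Downward induction on \<open>j\<close> shows that \<open>W\<close> contains all functions of \<open>L\<close> that vanish in degrees below \<open>j\<close>,
  starting from the assumption for \<open>j = N\<close>.\<close>
lemma coeff_submodule_full:
  assumes step: "\<And>g x. x \<in> W \<Longrightarrow> coeff_step q lam1 g x \<in> W"
    and diff: "\<And>x y. x \<in> W \<Longrightarrow> y \<in> W \<Longrightarrow> x - y \<in> W"
    and scale: "\<And>c x. x \<in> W \<Longrightarrow> coeff_scale c x \<in> W"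
    and WL: "W \<subseteq> L" and per: "\<And>x. x \<in> L \<Longrightarrow> periodic x"
    and Ldiff: "\<And>x y. x \<in> L \<Longrightarrow> y \<in> L \<Longrightarrow> x - y \<in> L"
    and deep: "\<And>x. x \<in> L \<Longrightarrow> (\<And>m n. m < N \<Longrightarrow> x m n = 0) \<Longrightarrow> x \<in> W"
    and w0: "w0 \<in> W" "w0 m0 n0 \<noteq> 0" "m0 < l"
  shows "L \<subseteq> W"
proof -
  obtain w1 where "w1 \<in> W" "w1 0 n0 \<noteq> 0"
    using exists_nonzero_degree_0[OF step w0] by blast
  then have "supp (w1 0) \<noteq> {}" using periodic_zero_iff[of w1 0 n0] per WL by blast
  then obtain w n1 where w: "w \<in> W" "supp (w 0) = {n1}"
    using exists_isolated[OF step diff scale \<open>w1 \<in> W\<close>] by blast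
  have "n1 < l" using w(2) by (auto simp: supp_def)
  have "\<forall>x\<in>L. (\<forall>m<j. \<forall>n. x m n = 0) \<longrightarrow> x \<in> W" if "j \<le> N" for j
    using that
  proof (induction j rule: inc_induct)
    case base
    then show ?case using deep by blast
  next
    case (step j)
    \<comment> \<open>An inner induction removes the coefficients of \<open>x\<close> in degree \<open>j\<close> one by one.\<close>
    have "x \<in> W" if "x \<in> L" "\<forall>m<j. \<forall>n. x m n = 0" for x
      using that
    proof (induction "card (supp (x j))" arbitrary: x rule: less_induct)
      case less
      note x = less.prems
      show ?case
      proof (cases "supp (x j) = {}")
        case True
        then have "x j n = 0" for n using periodic_zero_iff[OF per[OF x(1)], of j n] by simp
        then have "\<forall>m<Suc j. \<forall>n. x m n = 0" using x(2) by (auto simp: less_Suc_eq)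
        then show ?thesis using step.IH x(1) by blast
      next
        case False
        then obtain n2 where n2: "n2 \<in> supp (x j)" by blast
        \<comment> \<open>Shifting the isolated index \<open>n1\<close> to \<open>n2\<close> and raising by \<open>j\<close> gives an element that is
          concentrated at \<open>n2\<close> in degree \<open>j\<close>, with an uncontrolled tail in higher degrees only.\<close>
        define h where "h = V.act (\<lambda>m n. w m (n - (int n2 - int n1))) (Y ^ j)"
        have h: "h \<in> W" unfolding h_def by (intro raise_closed shift_closed assms(1) w(1))
        have hL: "h \<in> L" using h WL by blast
        have h_low: "h m n = 0" if "m < j" for m n using that by (simp add: h_def act_Y_power)
        have h_j: "h j n = q powi (- (n * int j)) * w 0 (n - (int n2 - int n1))" for n
          by (simp add: h_def act_Y_power)
        have "w 0 (int n1) \<noteq> 0" using w(2) by (auto simp: supp_def)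
        then have hn2: "h j (int n2) \<noteq> 0" using q0 by (simp add: h_j)
        have h_other: "k = n2" if "k < l" "h j (int k) \<noteq> 0" for k
        proof -
          have "w 0 (int k - (int n2 - int n1)) \<noteq> 0" using that(2) by (auto simp: h_j)
          then have "nat ((int k - (int n2 - int n1)) mod int l) = n1"
            using periodic_zero_iff[OF per, of w 0] w WL by auto
          then have "(int k - (int n2 - int n1)) mod int l = int n1 mod int l"
            using \<open>n1 < l\<close> l by (simp add: nat_eq_iff)
          then have "int l dvd int k - int n2" by (simp add: mod_eq_dvd_iff)
          moreover have "\<bar>int k - int n2\<bar> < int l" using that(1) n2 by (auto simp: supp_def)
          ultimately show "k = n2"
            using dvd_imp_le_int[of "int k - int n2" "int l"] by fastforce
        qed
        define c where "c = x j (int n2) / h j (int n2)"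
        have ch: "coeff_scale c h \<in> W" by (rule scale[OF h])
        define x' where "x' = x - coeff_scale c h"
        have x'L: "x' \<in> L" unfolding x'_def using Ldiff x(1) ch WL by blast
        have x'_low: "\<forall>m<j. \<forall>n. x' m n = 0"
          using x(2) h_low by (simp add: x'_def coeff_scale_def)
        have "supp (x' j) \<subseteq> supp (x j) - {n2}"
        proof
          fix k assume k: "k \<in> supp (x' j)"
          then have "k < l" "x' j (int k) \<noteq> 0" by (auto simp: supp_def)
          moreover have "x' j (int n2) = 0" using hn2 by (simp add: x'_def c_def coeff_scale_def)
          ultimately have "k \<noteq> n2" by auto
          then have "h j (int k) = 0" using h_other[OF \<open>k < l\<close>] by blast
          then show "k \<in> supp (x j) - {n2}"
            using \<open>k < l\<close> \<open>x' j (int k) \<noteq> 0\<close> \<open>k \<noteq> n2\<close> by (simp add: supp_def x'_def coeff_scale_def)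
        qed
        then have "card (supp (x' j)) < card (supp (x j))"
          using n2 by (intro psubset_card_mono finite_supp) blast
        then have "x' \<in> W" using less.hyps x'L x'_low by blast
        then have "x' - coeff_scale (- 1) (coeff_scale c h) \<in> W" by (intro diff scale ch)
        moreover have "x' - coeff_scale (- 1) (coeff_scale c h) = x"
          by (simp add: x'_def coeff_scale_def fun_eq_iff)
        ultimately show ?thesis by (simp only:)
      qed
    qed
    then show ?case by blast
  qed
  from this[of 0] show ?thesis by auto
qed

text \<open>Since \<open>coords\<close> is injective, a submodule whose image is everything is itself everything.\<close>
lemma verma_submodule_full:
  assumes W: "right_submodule W (qsa q) M" and deep: "deg_ge N \<subseteq> W" and nW: "\<not> W \<subseteq> deg_ge l"
  shows "W = carrier M"
proof -
  note Wc = M.submoduleD[OF W]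
  have "coords ` carrier M \<subseteq> coords ` W"
  proof -
    obtain x where x: "x \<in> W" "x \<notin> deg_ge l" using nW by blast
    then obtain m n where mn: "m < l" "coords x m n \<noteq> 0" using Wc(1) by (auto simp: deg_ge_def)
    show ?thesis
    proof (rule coeff_submodule_full[where N = N])
      show "coords x \<in> coords ` W" using x by blast
      show "coords x m n \<noteq> 0" "m < l" using mn by auto
      show "coeff_step q lam1 g y \<in> coords ` W" if y: "y \<in> coords ` W" for g y
      proof -
        from y obtain z where z: "y = coords z" "z \<in> W" by (rule imageE)
        have "z \<bullet> letter g \<in> W" using Wc(6)[OF z(2)] by (simp add: cls_simps(1))
        moreover have "coeff_step q lam1 g y = coords (z \<bullet> letter g)"
          using coords_dot[of z] z(2) Wc(1) by (simp add: z(1) subset_iff)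
        ultimately show ?thesis by (rule image_eqI[rotated])
      qed
      show "coeff_scale c y \<in> coords ` W" if y: "y \<in> coords ` W" for c y
      proof -
        from y obtain z where z: "y = coords z" "z \<in> W" by (rule imageE)
        have "z \<bullet> const c \<in> W" using Wc(6)[OF z(2)] by (simp add: cls_simps(1))
        moreover have "coeff_scale c y = coords (z \<bullet> const c)"
          using coords_dot[of z] z(2) Wc(1) by (simp add: z(1) subset_iff)
        ultimately show ?thesis by (rule image_eqI[rotated])
      qed
      show "y - z \<in> coords ` W" if yz: "y \<in> coords ` W" "z \<in> coords ` W" for y z
      proof -
        obtain a b where ab: "a \<in> W" "y = coords a" "b \<in> W" "z = coords b" using yz by blast
        then have "coords (a \<ominus>\<^bsub>M\<^esub> b) = y - z" using Wc(1) coords_diff[of a b] by blast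
        then show ?thesis using Wc(5)[OF ab(1,3)] by (metis imageI)
      qed
      show "y - z \<in> coords ` carrier M" if yz: "y \<in> coords ` carrier M" "z \<in> coords ` carrier M" for y z
      proof -
        obtain a b where ab: "a \<in> carrier M" "y = coords a" "b \<in> carrier M" "z = coords b" using yz by blast
        then have "coords (a \<ominus>\<^bsub>M\<^esub> b) = y - z" using coords_diff[of a b] by blast
        moreover have "a \<ominus>\<^bsub>M\<^esub> b \<in> carrier M" using ab by simp
        ultimately show ?thesis by (metis imageI)
      qed
      show "coords ` W \<subseteq> coords ` carrier M" using Wc(1) by blast
      show "periodic y" if "y \<in> coords ` carrier M" for y
        using that coords_periodic by (auto simp: periodic_def)
      show "y \<in> coords ` W" if "y \<in> coords ` carrier M" "\<And>m n. m < N \<Longrightarrow> y m n = 0" for y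
        using that deep by (auto simp: deg_ge_def)
    qed
  qed
  have "x \<in> W" if x: "x \<in> carrier M" for x
  proof -
    have "coords x \<in> coords ` W" using \<open>coords ` carrier M \<subseteq> coords ` W\<close> x by (rule subsetD[OF _ imageI])
    then obtain w where w: "coords x = coords w" "w \<in> W" by (rule imageE)
    then have "x = w" using coords_inj[OF x _ w(1)] Wc(1) by blast
    with w(2) show ?thesis by (simp only:)
  qed
  then show ?thesis using Wc(1) by blast
qed

section \<open>Quotients of the Verma module\<close>

lemma f_mem_deg_ge: "f m 0 \<in> deg_ge N \<longleftrightarrow> N \<le> m"
proof
  assume *: "f m 0 \<in> deg_ge N"
  have "coords (f m 0) m 0 \<noteq> 0" by (simp add: coords_f cyc_00)
  moreover have "coords (f m 0) m 0 = 0" if "m < N" using * that unfolding deg_ge_def by blast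
  ultimately show "N \<le> m" using not_le by blast
qed (auto simp: deg_ge_def coords_f)

lemma verma_quotient_local:
  assumes "p \<ge> 1"
  defines "L \<equiv> verma_quotient q l lam1 lam2 p"
    and "U \<equiv> (\<lambda>x. verma_sub q l lam1 lam2 p +>\<^bsub>M\<^esub> x) ` deg_ge l"
  shows "right_module (qsa q) L" "right_submodule U (qsa q) L" "U \<noteq> carrier L"
    "\<And>W. right_submodule W (qsa q) L \<Longrightarrow> \<not> W \<subseteq> U \<Longrightarrow> W = carrier L"
    "U = {\<zero>\<^bsub>L\<^esub>} \<longleftrightarrow> p = 1"
proof -
  let ?P = "verma_sub q l lam1 lam2 p"
  have L: "L = quotient_module M ?P" by (simp add: L_def verma_quotient_def)
  have P: "right_submodule ?P (qsa q) M" using deg_ge_submodule by (simp add: verma_sub_eq)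
  have D: "right_submodule (deg_ge l) (qsa q) M" using deg_ge_submodule[of 1] by simp
  have "l \<le> p * l" using assms(1) by simp
  then have "m < p * l" if "m < l" for m using that by linarith
  then have sub: "?P \<subseteq> deg_ge l" unfolding verma_sub_eq deg_ge_def by blast
  have ne: "deg_ge l \<noteq> carrier M"
  proof
    assume "deg_ge l = carrier M"
    then have "f 0 0 \<in> deg_ge l" by (simp only: f_carrier)
    then show False using l by (simp add: f_mem_deg_ge)
  qed
  have key: "W = carrier M" if "right_submodule W (qsa q) M" "?P \<subseteq> W" "\<not> W \<subseteq> deg_ge l" for W
    by (rule verma_submodule_full[OF that(1) that(2)[unfolded verma_sub_eq] that(3)])
  show "right_module (qsa q) L" unfolding L by (rule M.quotient_module_right_module[OF P])
  note loc = quotient_local[OF M.right_module_axioms P D sub ne]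
  show "right_submodule U (qsa q) L" "U \<noteq> carrier L"
    unfolding L U_def by (rule loc, rule key, assumption+)+
  show "W = carrier L" if "right_submodule W (qsa q) L" "\<not> W \<subseteq> U" for W
    unfolding L by (rule loc(3)[OF _ that[unfolded L U_def]], rule key, assumption+)
  have "U = {\<zero>\<^bsub>L\<^esub>} \<longleftrightarrow> deg_ge l = ?P"
    unfolding L U_def by (rule loc(4), rule key, assumption+)
  also have "\<dots> \<longleftrightarrow> p = 1"
  proof
    assume "deg_ge l = ?P"
    then have "p * l \<le> l" using f_mem_deg_ge[of l l] f_mem_deg_ge[of l "p * l"] by (simp add: verma_sub_eq)
    then show "p = 1" using assms(1) l by simp
  qed (simp add: verma_sub_eq)
  finally show "U = {\<zero>\<^bsub>L\<^esub>} \<longleftrightarrow> p = 1" .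
qed

end

theorem theorem6p1:
  fixes q lam1 lam2 :: "'k::alg_closed_field" and l :: nat
  assumes "l \<ge> 3" and "odd l"
    and "q ^ l = 1" and "\<And>k. 0 < k \<Longrightarrow> k < l \<Longrightarrow> q ^ k \<noteq> 1"
    and "lam1 \<noteq> 0" and "lam2 \<noteq> 0"
  shows "simple_module (qsa q) (verma_quotient q l lam1 lam2 1) \<and>
    (\<forall>p>1. \<not> simple_module (qsa q) (verma_quotient q l lam1 lam2 p) \<and>
           \<not> semisimple_module (qsa q) (verma_quotient q l lam1 lam2 p)) \<and>
    (\<forall>p>1. indecomposable_module (qsa q) (verma_quotient q l lam1 lam2 p))"
proof -
  interpret verma_params q lam1 lam2 l by unfold_locales (use assms in auto)
  show ?thesis
  proof (intro conjI allI impI)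
    note props = verma_quotient_local[OF order_refl]
    have U: "(\<lambda>x. verma_sub q l lam1 lam2 1 +>\<^bsub>M\<^esub> x) ` deg_ge l = {\<zero>\<^bsub>verma_quotient q l lam1 lam2 1\<^esub>}"
      using props(5) by (rule iffD2) (rule refl)
    show "simple_module (qsa q) (verma_quotient q l lam1 lam2 1)"
      by (rule simple_if_submodules_trivial[OF props(1) props(3)[symmetric, unfolded U]])
        (rule props(4)[unfolded U])
  next
    fix p :: nat assume "p > 1"
    then have p: "p \<ge> 1" "p \<noteq> 1" by auto
    note props = verma_quotient_local[OF p(1)]
    show "\<not> simple_module (qsa q) (verma_quotient q l lam1 lam2 p)"
      by (rule local_not_simple[OF props(2,3)]) (use props(5) p in blast)
    show "\<not> semisimple_module (qsa q) (verma_quotient q l lam1 lam2 p)"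
      by (rule local_not_semisimple[OF props(1-3)]) (use props(4,5) p in blast)+
    show "indecomposable_module (qsa q) (verma_quotient q l lam1 lam2 p)"
      by (rule local_indecomposable[OF props(1-3)]) (use props(4) in blast)
  qed
qed

end
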